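(* Let $n\ge 2$ and let $\mu$ be a finite and rotationally invariant Borel measure on $D_R^n$ for some $R\in(0,\infty)$. For $k \in \{1,\ldots,n\}$, there exists a unique radially symmetric convex function $u\colon D^n_R \to \mathbb{R}$ solving the problem \[ \begin{cases} \Phi_k(u;\cdot)=\mu &\text{ in } D_R^n, \\ u\equiv 0 &\text{ on } \mathrm{bd}(D_R^n), \end{cases} \] if and only if \[ r\mapsto \frac{\mu(D_r^n)}{r^{n-k}},\quad r\in(0,R], \] is non-decreasing. In this case, $u$ is given by \[ u(x) = -\int_{|x|}^R \left(\frac{\mu(D_r^n)}{\binom{n}{k}\kappa_n r^{n-k}}\right)^{\frac 1k} \,\mathrm{d} r \] for $x\in D_R^n$.
   Context: $D_r^n=\{x\in\mathbb{R}^n:|x|<r\}$ is the open Euclidean ball of radius $r$ centered at the origin, $|\cdot|$ is the Euclidean norm, $\mathrm{bd}$ denotes the boundary, and $\kappa_n$ is the volume of the unit ball in $\mathbb{R}^n$. A measure $\mu$ on $D_R^n$ is rotationally invariant if $\mu(\vartheta B)=\mu(B)$ for every rotation $\vartheta\in\mathrm{SO}(n)$ of $\mathbb{R}^n$ and every Borel $B\subseteq D_R^n$. A function on $D_R^n$ is radially symmetric if its value at $x$ depends only on $|x|$. The boundary condition $u\equiv 0$ on $\mathrm{bd}(D_R^n)$ means that $u$ extends continuously to $\mathrm{bd}(D_R^n)$ with value $0$ there. For a finite-valued convex function $u$ on an open convex set $\Omega\subseteq\mathbb{R}^n$, the subdifferential at $x\in\Omega$ is $\partial u(x)=\{p\in\mathbb{R}^n: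 u(z)\ge u(x)+\langle p,z-x\rangle\ \text{for all } z\in\Omega\}$. The Hessian measures $\Phi_k(u;\cdot)$, $k\in\{0,\ldots,n\}$, are the Radon measures on $\Omega$ determined by \[ \mathrm{vol}_n\big(\{x+\lambda p: x\in B,\ p\in\partial u(x)\}\big)=\sum_{k=0}^n\lambda^k\,\Phi_k(u;B) \] for all $\lambda\ge 0$ and Borel $B\subseteq\Omega$. (If $u\in C^2$, then $\mathrm{d}\Phi_k(u;x)=[\mathrm{D}^2u(x)]_k\,\mathrm{d}x$, with $[\cdot]_k$ the $k$th elementary symmetric function of the eigenvalues.) *)

theory Defs
  imports "HOL-Analysis.Analysis"
begin

definition subdifferential :: "'a::euclidean_space set \<Rightarrow> ('a \<Rightarrow> real) \<Rightarrow> 'a \<Rightarrow> 'a set"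
  where "subdifferential \<Omega> u x = {p. \<forall>z\<in>\<Omega>. u z \<ge> u x + p \<bullet> (z - x)}"

text \<open>A Borel measure on an open subset of a Euclidean space that is finite on compact sets is
  automatically regular, so local finiteness is the only requirement.\<close>

definition radon_measure_on :: "'a::euclidean_space set \<Rightarrow> 'a measure \<Rightarrow> bool"
  where "radon_measure_on \<Omega> M \<longleftrightarrow>
    sets M = sets (restrict_space borel \<Omega>) \<and>
    (\<forall>K. compact K \<and> K \<subseteq> \<Omega> \<longrightarrow> emeasure M K < \<infinity>)"

text \<open>Both sides of the Steiner-type formula are extended-valued, since they may be infinite when
  \<open>B\<close> is not relatively compact in \<open>\<Omega>\<close>. The case \<open>t = 0\<close> uses \<open>0 ^ 0 = 1\<close>.\<close>

definition has_hessian_measures ::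
    "'a::euclidean_space set \<Rightarrow> ('a \<Rightarrow> real) \<Rightarrow> (nat \<Rightarrow> 'a measure) \<Rightarrow> bool"
  where "has_hessian_measures \<Omega> u \<Phi> \<longleftrightarrow>
    (\<forall>k\<le>DIM('a). radon_measure_on \<Omega> (\<Phi> k)) \<and>
    (\<forall>t\<ge>0. \<forall>B\<in>sets borel. B \<subseteq> \<Omega> \<longrightarrow>
      emeasure lborel {x + t *\<^sub>R p | x p. x \<in> B \<and> p \<in> subdifferential \<Omega> u x} =
      (\<Sum>k\<le>DIM('a). ennreal (t ^ k) * emeasure (\<Phi> k) B))"

text \<open>For convex \<open>u\<close> on an open convex \<open>\<Omega>\<close> the measures \<open>\<Phi> 0, \<dots>, \<Phi> n\<close> with \<open>n = DIM('a)\<close>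
  exist and are unique. The indices \<open>k > n\<close> are not meaningful.\<close>

definition hessian_measure ::
    "'a::euclidean_space set \<Rightarrow> nat \<Rightarrow> ('a \<Rightarrow> real) \<Rightarrow> 'a measure"
  where "hessian_measure \<Omega> k u = (THE M. \<exists>\<Phi>. has_hessian_measures \<Omega> u \<Phi> \<and> M = \<Phi> k)"

definition rotation_invariant :: "(real^'n) measure \<Rightarrow> bool"
  where "rotation_invariant M \<longleftrightarrow>
    (\<forall>Q::real^'n^'n. \<forall>B\<in>sets M.
      rotation_matrix Q \<longrightarrow> emeasure M ((*v) Q ` B) = emeasure M B)"

definition radially_symmetric_on :: "'a::real_normed_vector set \<Rightarrow> ('a \<Rightarrow> 'b) \<Rightarrow> bool"
  where "radially_symmetric_on \<Omega> u \<longleftrightarrow> (\<forall>x\<in>\<Omega>. \<forall>y\<in>\<Omega>. norm x = norm y \<longrightarrow> u x = u y)"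

definition zero_boundary_values :: "'a::euclidean_space set \<Rightarrow> ('a \<Rightarrow> real) \<Rightarrow> bool"
  where "zero_boundary_values \<Omega> u \<longleftrightarrow>
    (\<exists>v. continuous_on (closure \<Omega>) v \<and> (\<forall>x\<in>\<Omega>. v x = u x) \<and> (\<forall>x\<in>frontier \<Omega>. v x = 0))"

text \<open>Functions \<open>\<Omega> \<rightarrow> \<real>\<close> are represented by total functions that are \<^const>\<open>undefined\<close> outside
  \<open>\<Omega>\<close>, so that uniqueness refers to the values on \<open>\<Omega>\<close> only.\<close>

definition radial_hessian_solution ::
    "real \<Rightarrow> nat \<Rightarrow> (real^'n) measure \<Rightarrow> (real^'n \<Rightarrow> real) \<Rightarrow> bool"
  where "radial_hessian_solution R k \<mu> u \<longleftrightarrow>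
    u \<in> extensional (ball 0 R) \<and>
    radially_symmetric_on (ball 0 R) u \<and>
    convex_on (ball 0 R) u \<and>
    hessian_measure (ball 0 R) k u = \<mu> \<and>
    zero_boundary_values (ball 0 R) u"

end

theory Submission
  imports Defs
begin

text \<open>
  A radial convex function \<open>u x = \<phi> (norm x)\<close> on the ball has the left derivative \<open>w\<close> of \<open>\<phi>\<close> as its
  only datum. For \<open>t \<ge> 0\<close> the map \<open>x \<mapsto> x + t *\<^sub>R \<partial>u x\<close> has a single-valued radial inverse, and it
  sends \<open>ball 0 r\<close> to \<open>ball 0 (r + t * w r)\<close> up to a null set. Expanding the volume by the binomial
  theorem gives \<open>\<Phi>\<^sub>k(u; ball 0 r) = (n choose k) * \<kappa>\<^sub>n * r ^ (n - k) * w r ^ k\<close>. A rotation invariant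
  measure on the ball is determined by its values on centred balls (its Laplace transform is radial,
  and averaging it over directions leaves only the radial marginal), so \<open>\<Phi>\<^sub>k(u) = \<mu>\<close> is equivalent to
  \<open>w r = (\<mu> (ball 0 r) / ((n choose k) * \<kappa>\<^sub>n * r ^ (n - k))) powr (1 / k)\<close>. Such a \<open>w\<close> is the slope of
  a convex function iff it is non-decreasing, and \<open>u\<close> is recovered by integration.
\<close>

section \<open>Rotation invariant measures\<close>

text \<open>\<open>hessian_measure\<close> is a definite description, so nothing is known about it
  until existence and uniqueness of the measures have been proved. For radial functions existence is
  obtained by an explicit construction: the left side of the Steiner formula and each coefficient
  measure are images of Lebesgue measure under radial maps. An \<open>n\<close>-th root turns the
  prescribed mass of a ball into the radius of a ball with that volume. The mass of an open ball is
  continuous from the left in its radius. This is why the left derivative of the profile appears and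
  why all monotone functions here are left continuous. They may jump, be constant, or have a
  positive limit at 0, so the radial maps come from generalized inverses, and the origin is treated
  separately as a null set. Real exponentials are used instead of characters because their integrals
  are nonnegative: they can be exchanged without integrability conditions, and real
  Stone-Weierstrass applies.\<close>

lemma rotation_matrix_vector_mult:
  fixes Q :: "real^'n^'n"
  assumes "rotation_matrix Q"
  shows norm_rotation: "norm (Q *v x) = norm x"
    and inner_rotation: "(Q *v x) \<bullet> (Q *v y) = x \<bullet> y"
    and surj_rotation: "surj ((*v) Q)"
    and inj_rotation: "inj ((*v) Q)"
    and orthogonal_rotation: "orthogonal_transformation ((*v) Q)"
proof -
  have "orthogonal_matrix Q" using assms by (simp add: rotation_matrix_def)
  then show o: "orthogonal_transformation ((*v) Q)"
    by (simp add: orthogonal_transformation_matrix)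
  show "norm (Q *v x) = norm x" using o by (simp add: orthogonal_transformation)
  show "(Q *v x) \<bullet> (Q *v y) = x \<bullet> y" using o by (simp add: orthogonal_transformation_def)
  show "surj ((*v) Q)" by (rule orthogonal_transformation_surj[OF o])
  show "inj ((*v) Q)" by (rule orthogonal_transformation_inj[OF o])
qed

lemma rotation_matrix_exists:
  fixes a b :: "real^'n"
  assumes "CARD('n) \<ge> 2" "norm a = norm b"
  obtains Q :: "real^'n^'n" where "rotation_matrix Q" "Q *v a = b"
proof -
  obtain f where f: "orthogonal_transformation f" "det (matrix f) = 1" "f a = b"
    using rotation_exists[OF assms] by blast
  moreover from f have "orthogonal_matrix (matrix f)" "linear f"
    by (auto simp: orthogonal_transformation_matrix)
  ultimately show thesis
    by (intro that[of "matrix f"]) (auto simp: rotation_matrix_def)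
qed

lemma measurable_rotation [measurable]: "((*v) (Q :: real^'n^'n)) \<in> borel_measurable borel"
  by (intro borel_measurable_continuous_onI linear_continuous_on matrix_vector_mul_bounded_linear)

lemma rotation_image_ball:
  fixes Q :: "real^'n^'n"
  assumes "rotation_matrix Q"
  shows "(*v) Q ` ball 0 r = ball 0 r"
proof -
  have "y \<in> (*v) Q ` ball 0 r" if "norm y < r" for y
  proof -
    obtain x where "y = Q *v x" using surj_rotation[OF assms] by (meson surjD)
    then show ?thesis using that norm_rotation[OF assms] by auto
  qed
  then show ?thesis using norm_rotation[OF assms] by auto
qed

lemma borel_rotation_image:
  fixes Q :: "real^'n^'n"
  assumes "rotation_matrix Q" "B \<in> sets borel"
  shows "(*v) Q ` B \<in> sets borel"
proof -
  interpret linear "(*v) Q" by simp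
  obtain g where g: "linear g" "g \<circ> (*v) Q = id"
    using linear_injective_left_inverse[OF _ inj_rotation[OF assms(1)]] by auto
  have "(*v) Q ` B = g -` B"
  proof -
    have gq: "g (Q *v x) = x" for x using g(2) by (metis comp_apply id_apply)
    then show ?thesis using surj_rotation[OF assms(1)] by (auto simp: image_iff) (metis surjD)
  qed
  moreover have "g \<in> borel_measurable borel"
    by (intro borel_measurable_continuous_onI linear_continuous_on linear_conv_bounded_linear[THEN iffD1] g(1))
  ultimately show ?thesis
    using measurable_sets_borel[of g borel B] assms(2) by simp
qed

lemma distr_rotation:
  fixes M :: "(real^'n) measure"
  assumes "rotation_invariant M" "sets M = sets borel" "rotation_matrix Q"
  shows "distr M borel ((*v) Q) = M"
proof (rule measure_eqI)
  fix B assume "B \<in> sets (distr M borel ((*v) Q))"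
  then have B: "B \<in> sets borel" by simp
  have Q: "(*v) Q \<in> measurable M borel" using assms(2) measurable_rotation measurable_cong_sets by blast
  have sp: "space M = UNIV" using assms(2) sets_eq_imp_space_eq by fastforce
  have "(*v) Q -` B \<in> sets M"
    using measurable_sets[OF Q B] sp by simp
  then have "emeasure M ((*v) Q ` ((*v) Q -` B)) = emeasure M ((*v) Q -` B)"
    using assms(1,3) unfolding rotation_invariant_def by blast
  moreover have "(*v) Q ` ((*v) Q -` B) = B"
    using surj_rotation[OF assms(3)] by (simp add: surj_image_vimage_eq)
  ultimately show "emeasure (distr M borel ((*v) Q)) B = emeasure M B"
    using B Q sp by (simp add: emeasure_distr)
qed (simp add: assms)

section \<open>Lebesgue measure under orthogonal maps\<close>

lemma nn_integral_lborel_translate: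
  fixes g :: "'a::euclidean_space \<Rightarrow> ennreal"
  assumes [measurable]: "g \<in> borel_measurable borel"
  shows "(\<integral>\<^sup>+y. g (y - x) \<partial>lborel) = (\<integral>\<^sup>+y. g y \<partial>lborel)"
    and "(\<integral>\<^sup>+y. g (x - y) \<partial>lborel) = (\<integral>\<^sup>+y. g y \<partial>lborel)"
proof -
  have "lborel = distr lborel borel (\<lambda>y. -x + 1 *\<^sub>R y)" "lborel = distr lborel borel (\<lambda>y. x + (-1) *\<^sub>R y)"
    using lborel_affine[of 1 "-x"] lborel_affine[of "-1" x] by (simp_all add: density_1)
  then have "(\<integral>\<^sup>+y. g y \<partial>lborel) = (\<integral>\<^sup>+y. g y \<partial>distr lborel borel (\<lambda>y. -x + 1 *\<^sub>R y))"
    "(\<integral>\<^sup>+y. g y \<partial>lborel) = (\<integral>\<^sup>+y. g y \<partial>distr lborel borel (\<lambda>y. x + (-1) *\<^sub>R y))"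
    by simp_all
  then show "(\<integral>\<^sup>+y. g (y - x) \<partial>lborel) = (\<integral>\<^sup>+y. g y \<partial>lborel)"
    "(\<integral>\<^sup>+y. g (x - y) \<partial>lborel) = (\<integral>\<^sup>+y. g y \<partial>lborel)"
    by (simp_all add: nn_integral_distr)
qed

text \<open>The image measure is translation invariant, hence a multiple of \<^const>\<open>lborel\<close> by Fubini;
  the factor is 1 because the unit ball is preserved.\<close>

lemma distr_lborel_orthogonal:
  fixes f :: "'a::euclidean_space \<Rightarrow> 'a"
  assumes f: "orthogonal_transformation f"
  shows "distr lborel borel f = lborel"
proof -
  have lin: "linear f" using f by (simp add: orthogonal_transformation_linear)
  then have [measurable]: "f \<in> borel_measurable borel"
    by (intro borel_measurable_continuous_onI linear_continuous_on) (simp add: linear_conv_bounded_linear)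
  define \<nu> where "\<nu> = distr lborel borel f"
  have [simp, measurable_cong]: "sets \<nu> = sets borel" by (simp add: \<nu>_def)
  have translate: "(\<integral>\<^sup>+y. indicator B (y - x) \<partial>\<nu>) = emeasure \<nu> B" if [measurable]: "B \<in> sets borel" for B x
  proof -
    obtain z where z: "x = f z" using orthogonal_transformation_surj[OF f] by (meson surjD)
    have "(\<integral>\<^sup>+y. indicator B (y - x) \<partial>\<nu>) = (\<integral>\<^sup>+y. indicator B (f (y - z)) \<partial>lborel)"
      unfolding \<nu>_def z by (subst nn_integral_distr) (auto simp: linear_diff[OF lin])
    also have "\<dots> = (\<integral>\<^sup>+y. indicator B (f y) \<partial>lborel)"
      by (rule nn_integral_lborel_translate(1)[where g="\<lambda>y. indicator B (f y)"]) measurable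
    also have "\<dots> = (\<integral>\<^sup>+y. indicator B y \<partial>\<nu>)"
      unfolding \<nu>_def by (subst nn_integral_distr) auto
    finally show ?thesis by simp
  qed
  have unit_ball: "f -` ball 0 1 = ball 0 1"
    using f by (auto simp: orthogonal_transformation)
  have "emeasure \<nu> (ball 0 r) = emeasure lborel (ball (0::'a) r)" for r
  proof -
    have "f -` ball 0 r = ball 0 r" using f by (auto simp: orthogonal_transformation)
    then show ?thesis by (simp add: \<nu>_def emeasure_distr)
  qed
  then have "sigma_finite_measure \<nu>"
    by (intro sigma_finite_measure.intro exI[of _ "range (\<lambda>n::nat. ball 0 (real n))"])
      (auto simp: emeasure_ball \<nu>_def[THEN arg_cong[where f=space]] reals_Archimedean2)
  then interpret \<nu>: sigma_finite_measure \<nu> .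
  interpret pair_sigma_finite \<nu> lborel
    by (intro pair_sigma_finite.intro \<nu>.sigma_finite_measure_axioms sigma_finite_lborel)
  interpret swap: pair_sigma_finite lborel \<nu> ..
  let ?D = "ball (0::'a) 1"
  have D [measurable]: "?D \<in> sets borel" by simp
  have "emeasure \<nu> A = emeasure lborel A" if [measurable]: "A \<in> sets borel" for A
  proof -
    have "emeasure lborel A * emeasure \<nu> ?D = (\<integral>\<^sup>+x. indicator A x * emeasure \<nu> ?D \<partial>lborel)"
      by (simp add: nn_integral_multc)
    also have "\<dots> = (\<integral>\<^sup>+x. (\<integral>\<^sup>+y. indicator A x * indicator ?D (y - x) \<partial>\<nu>) \<partial>lborel)"
      by (intro nn_integral_cong, subst nn_integral_cmult) (measurable, simp add: translate[OF D])
    also have "\<dots> = (\<integral>\<^sup>+y. (\<integral>\<^sup>+x. indicator A x * indicator ?D (y - x) \<partial>lborel) \<partial>\<nu>)"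
      by (subst Fubini') auto
    \<comment> \<open>Reflecting \<open>x\<close> to \<open>y - x\<close> moves the difference from
      \<open>?D\<close> to \<open>A\<close>. Integrating over \<open>y\<close> first then produces
      \<nu>(A) instead of \<nu>(\<open>?D\<close>).\<close>
    also have "\<dots> = (\<integral>\<^sup>+y. (\<integral>\<^sup>+x. indicator A (y - x) * indicator ?D x \<partial>lborel) \<partial>\<nu>)"
    proof (rule nn_integral_cong)
      fix y
      show "(\<integral>\<^sup>+x. indicator A x * indicator ?D (y - x) \<partial>lborel) =
          (\<integral>\<^sup>+x. indicator A (y - x) * indicator ?D x \<partial>lborel)"
        using nn_integral_lborel_translate(2)[of "\<lambda>x. indicator A (y - x) * indicator ?D x" y] by simp
    qed
    also have "\<dots> = (\<integral>\<^sup>+x. (\<integral>\<^sup>+y. indicator A (y - x) * indicator ?D x \<partial>\<nu>) \<partial>lborel)"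
      by (subst Fubini') auto
    also have "\<dots> = (\<integral>\<^sup>+x. emeasure \<nu> A * indicator ?D x \<partial>lborel)"
      by (intro nn_integral_cong) (simp add: nn_integral_multc translate)
    also have "\<dots> = emeasure \<nu> A * emeasure lborel ?D"
      by (simp add: nn_integral_cmult)
    also have "emeasure \<nu> ?D = emeasure lborel ?D"
      using unit_ball by (simp add: \<nu>_def emeasure_distr)
    finally show ?thesis
      by (simp add: emeasure_ball mult_right_ennreal_cancel not_le[THEN iffD2, OF unit_ball_vol_pos])
  qed
  then show ?thesis by (intro measure_eqI) (auto simp: \<nu>_def)
qed

lemma rotation_invariant_lborel:
  fixes Q :: "real^'n^'n"
  assumes "rotation_matrix Q" "B \<in> sets borel"
  shows "emeasure lborel ((*v) Q ` B) = emeasure lborel B"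
proof -
  have "emeasure lborel ((*v) Q ` B) = emeasure (distr lborel borel ((*v) Q)) ((*v) Q ` B)"
    by (simp add: distr_lborel_orthogonal orthogonal_rotation[OF assms(1)])
  also have "\<dots> = emeasure lborel ((*v) Q -` ((*v) Q ` B))"
    using borel_rotation_image[OF assms] by (simp add: emeasure_distr)
  also have "(*v) Q -` ((*v) Q ` B) = B"
    using inj_rotation[OF assms(1)] by (simp add: inj_vimage_image_eq)
  finally show ?thesis .
qed

text \<open>By rotation invariance the left-hand side does not change when \<open>\<xi>\<close> is replaced by
  \<open>norm \<xi> *\<^sub>R sgn y\<close>; averaging over \<open>y\<close> and exchanging the integrals leaves a radial integrand.\<close>

lemma nn_integral_exp_rotation_invariant:
  fixes M :: "(real^'n) measure"
  assumes card: "CARD('n) \<ge> 2" and M: "rotation_invariant M" "sets M = sets borel" "finite_measure M"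
  shows "(\<integral>\<^sup>+x. ennreal (exp (\<xi> \<bullet> x)) \<partial>M) * emeasure lborel (ball (0::real^'n) 1) =
    (\<integral>\<^sup>+s. (\<integral>\<^sup>+y. ennreal (exp (norm \<xi> * s * (sgn y \<bullet> axis undefined 1))) *
      indicator (ball (0::real^'n) 1) y \<partial>lborel) \<partial>distr M borel norm)"
proof -
  interpret finite_measure M by fact
  interpret pair_sigma_finite M lborel
    by (intro pair_sigma_finite.intro sigma_finite_measure_axioms sigma_finite_lborel)
  note [measurable_cong] = M(2)
  have [measurable]: "sgn \<in> borel_measurable (borel :: (real^'n) measure)"
    unfolding sgn_div_norm by measurable
  let ?D = "ball (0::real^'n) 1"
  have D [measurable]: "?D \<in> sets borel" by simp
  \<comment> \<open>Any fixed unit vector would serve; \<open>undefined\<close> merely selects some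
    coordinate.\<close>
  define e :: "real^'n" where "e = axis undefined 1"
  have e: "norm e = 1" by (simp add: e_def)
  define L where "L \<xi> = (\<integral>\<^sup>+x. ennreal (exp (\<xi> \<bullet> x)) \<partial>M)" for \<xi> :: "real^'n"
  have L: "L \<eta> = L \<xi>" if eq: "norm \<eta> = norm \<xi>" for \<eta> \<xi> :: "real^'n"
  proof -
    obtain Q :: "real^'n^'n" where Q: "rotation_matrix Q" "Q *v \<eta> = \<xi>"
      using rotation_matrix_exists[OF card eq] .
    have "L \<xi> = (\<integral>\<^sup>+x. ennreal (exp (\<xi> \<bullet> x)) \<partial>distr M borel ((*v) Q))"
      by (simp add: L_def distr_rotation[OF M(1,2) Q(1)])
    also have "\<dots> = (\<integral>\<^sup>+x. ennreal (exp (\<xi> \<bullet> (Q *v x))) \<partial>M)"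
      by (subst nn_integral_distr) auto
    also have "\<dots> = L \<eta>"
      unfolding L_def Q(2)[symmetric] inner_rotation[OF Q(1)] ..
    finally show ?thesis by simp
  qed
  define H where "H x = (\<integral>\<^sup>+y. ennreal (exp (norm \<xi> * (sgn y \<bullet> x))) * indicator ?D y \<partial>lborel)" for x
  \<comment> \<open>The average over directions inherits radial symmetry from the rotation
    invariance of Lebesgue measure.\<close>
  have H: "H x = H (norm x *\<^sub>R e)" for x
  proof -
    have "norm (norm x *\<^sub>R e) = norm x" using e by simp
    then obtain Q :: "real^'n^'n" where Q: "rotation_matrix Q" "Q *v (norm x *\<^sub>R e) = x"
      using rotation_matrix_exists[OF card] by blast
    have sgnQ: "sgn (Q *v y) = Q *v sgn y" for y
      using norm_rotation[OF Q(1)]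
      by (simp add: sgn_div_norm linear_scale)
    have "H x = (\<integral>\<^sup>+y. ennreal (exp (norm \<xi> * (sgn y \<bullet> x))) * indicator ?D y \<partial>distr lborel borel ((*v) Q))"
      by (simp add: H_def distr_lborel_orthogonal orthogonal_rotation[OF Q(1)])
    also have "\<dots> = (\<integral>\<^sup>+y. ennreal (exp (norm \<xi> * (sgn (Q *v y) \<bullet> x))) * indicator ?D (Q *v y) \<partial>lborel)"
      by (rule nn_integral_distr) measurable
    also have "\<dots> = H (norm x *\<^sub>R e)"
      unfolding H_def sgnQ
      by (subst (1) Q(2)[symmetric]) (simp only: inner_rotation[OF Q(1)] indicator_def mem_ball dist_0_norm norm_rotation[OF Q(1)])
    finally show ?thesis .
  qed
  have "L \<xi> * emeasure lborel ?D = (\<integral>\<^sup>+y. L \<xi> * indicator ?D y \<partial>lborel)"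
    by (simp add: nn_integral_cmult_indicator)
  \<comment> \<open>Only almost everywhere, since \<open>sgn 0 = 0\<close> does not have norm
    1.\<close>
  also have "\<dots> = (\<integral>\<^sup>+y. L (norm \<xi> *\<^sub>R sgn y) * indicator ?D y \<partial>lborel)"
  proof (rule nn_integral_cong_AE)
    have "AE y in lborel. y \<noteq> (0::real^'n)" by (rule AE_lborel_singleton)
    then show "AE y in lborel. L \<xi> * indicator ?D y = L (norm \<xi> *\<^sub>R sgn y) * indicator ?D y"
      by eventually_elim (auto simp: norm_sgn intro!: arg_cong2[where f="(*)"] L)
  qed
  also have "\<dots> = (\<integral>\<^sup>+y. (\<integral>\<^sup>+x. ennreal (exp (norm \<xi> * (sgn y \<bullet> x))) * indicator ?D y \<partial>M) \<partial>lborel)"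
    unfolding L_def inner_scaleR_left by (intro nn_integral_cong) (simp add: nn_integral_multc)
  also have "\<dots> = (\<integral>\<^sup>+x. (\<integral>\<^sup>+y. ennreal (exp (norm \<xi> * (sgn y \<bullet> x))) * indicator ?D y \<partial>lborel) \<partial>M)"
    by (subst Fubini') auto
  also have "\<dots> = (\<integral>\<^sup>+x. H (norm x *\<^sub>R e) \<partial>M)"
    by (rule nn_integral_cong, fold H_def, rule H)
  also have "\<dots> = (\<integral>\<^sup>+s. H (s *\<^sub>R e) \<partial>distr M borel norm)"
    unfolding H_def by (subst nn_integral_distr) auto
  finally show ?thesis by (simp add: L_def H_def e_def mult.assoc)
qed

section \<open>Exponential sums as a determining class for measures\<close>

inductive_set exp_span :: "(real^'n \<Rightarrow> real) set" where
  exp: "(\<lambda>x. c * exp (\<xi> \<bullet> x)) \<in> exp_span"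
| add: "f \<in> exp_span \<Longrightarrow> g \<in> exp_span \<Longrightarrow> (\<lambda>x. f x + g x) \<in> exp_span"

lemma exp_span_mult:
  assumes "f \<in> exp_span" "g \<in> exp_span"
  shows "(\<lambda>x. f x * g x) \<in> exp_span"
  using assms
proof induction
  case (exp c \<xi>)
  from this show ?case
  proof induction
    case (exp d \<eta>)
    have "(\<lambda>x. c * exp (\<xi> \<bullet> x) * (d * exp (\<eta> \<bullet> x))) = (\<lambda>x. (c * d) * exp ((\<xi> + \<eta>) \<bullet> x))"
      by (simp add: fun_eq_iff inner_add_left exp_add mult_ac)
    then show ?case using exp_span.exp[of "c*d" "\<xi> + \<eta>"] by simp
  next
    case (add f g)
    then show ?case using exp_span.add by (fastforce simp: distrib_left)
  qed
next
  case (add f g)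
  then show ?case using exp_span.add by (fastforce simp: distrib_right)
qed

lemma exp_span_continuous: "f \<in> exp_span \<Longrightarrow> continuous_on S f"
  by (induction rule: exp_span.induct) (auto intro!: continuous_intros)

text \<open>Stone-Weierstrass: exponents add under multiplication, so the exponential sums form an
  algebra, and the exponent \<open>x - y\<close> separates \<open>x\<close> from
  \<open>y\<close>.\<close>

lemma exp_span_approx:
  fixes f :: "real^'n \<Rightarrow> real"
  assumes "compact S" "continuous_on S f" "\<epsilon> > 0"
  shows "\<exists>g\<in>exp_span. \<forall>x\<in>S. \<bar>f x - g x\<bar> < \<epsilon>"
proof -
  have const: "(\<lambda>x. c) \<in> exp_span" for c
    using exp_span.exp[of c 0] by simp
  interpret function_ring_on exp_span S
  proof
    fix x y :: "real^'n" assume "x \<noteq> y"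
    then have "(x - y) \<bullet> (x - y) \<noteq> 0" by simp
    then have "(x - y) \<bullet> x \<noteq> (x - y) \<bullet> y" by (simp add: inner_diff_right)
    then show "\<exists>f\<in>exp_span. f x \<noteq> f y"
      by (intro bexI[OF _ exp_span.exp[of 1 "x - y"]]) simp
  qed (use assms const in \<open>auto intro: exp_span_continuous exp_span_mult exp_span.add\<close>)
  show ?thesis using Stone_Weierstrass_basic assms by blast
qed

text \<open>Closed sets are an intersection-stable generator, and the indicator of a closed set is a
  bounded pointwise limit of continuous cut-offs of the distance function.\<close>

lemma finite_measure_eqI_continuous:
  fixes M N :: "'a::euclidean_space measure"
  assumes sets: "sets M = sets borel" "sets N = sets borel"
    and fin: "finite_measure M" "finite_measure N"
    and eq: "\<And>f :: 'a \<Rightarrow> real. continuous_on UNIV f \<Longrightarrow> (\<And>x. \<bar>f x\<bar> \<le> 1) \<Longrightarrow> integral\<^sup>L M f = integral\<^sup>L N f"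
  shows "M = N"
proof -
  interpret M: finite_measure M by fact
  interpret N: finite_measure N by fact
  \<comment> \<open>The empty set is excluded because \<open>infdist\<close> to it is 0 by
    convention, which would make every cut-off equal to 1.\<close>
  have closed: "measure M C = measure N C" if "closed C" "C \<noteq> {}" for C
  proof -
    define f where "f m x = max 0 (1 - real m * infdist x C)" for m x
    have lim: "(\<lambda>m. f m x) \<longlonglongrightarrow> indicator C x" for x
    proof (cases "x \<in> C")
      case False
      then have p: "infdist x C > 0"
        using that infdist_pos_not_in_closed by blast
      have "eventually (\<lambda>m. f m x = 0) sequentially"
        using eventually_ge_at_top[of "nat \<lceil>1 / infdist x C\<rceil>"]
      proof eventually_elim
        case (elim m)
        then have "1 / infdist x C \<le> real m" by linarith
        then show ?case using p by (simp add: f_def field_simps)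
      qed
      then show ?thesis using False by (simp add: tendsto_eventually)
    qed (simp add: f_def)
    have cont: "continuous_on UNIV (f m)" for m
      unfolding f_def by (intro continuous_intros)
    have bd: "\<bar>f m x\<bar> \<le> 1" for m x
      unfolding f_def using infdist_nonneg[of x C] by (auto simp: max_def)
    have [measurable]: "C \<in> sets borel" using that by auto
    have meas: "f m \<in> borel_measurable borel" for m
      by (intro borel_measurable_continuous_onI cont)
    have "(\<lambda>m. integral\<^sup>L K (f m)) \<longlonglongrightarrow> measure K C"
      if K: "finite_measure K" "sets K = sets borel" for K
    proof -
      interpret K: finite_measure K by fact
      note [measurable_cong] = K(2)
      have sp: "space K = UNIV" using sets_eq_imp_space_eq[OF K(2)] by simp
      have "(\<lambda>m. integral\<^sup>L K (f m)) \<longlonglongrightarrow> integral\<^sup>L K (indicator C :: 'a \<Rightarrow> real)"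
        by (rule integral_dominated_convergence[where w="\<lambda>_. 1"])
          (use lim bd meas K(2) in \<open>auto cong: measurable_cong_sets\<close>)
      then show ?thesis using sp by simp
    qed
    moreover have "integral\<^sup>L M (f m) = integral\<^sup>L N (f m)" for m
      by (intro eq cont bd)
    ultimately show ?thesis
      using fin sets LIMSEQ_unique by (metis (no_types, lifting) ext)
  qed
  show ?thesis
  proof (rule measure_eqI_generator_eq[where E="{C. closed C}" and \<Omega>=UNIV and A="\<lambda>_. UNIV"])
    fix C :: "'a set" assume "C \<in> {C. closed C}"
    then show "emeasure M C = emeasure N C"
      using closed[of C] by (cases "C = {}") (auto simp: M.emeasure_eq_measure N.emeasure_eq_measure)
  qed (auto simp: Int_stable_def sets borel_eq_closed intro: closed_Int)
qed

text \<open>Equal masses of centred balls mean equal images under \<open>norm\<close>, hence equal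
  Laplace transforms. The common bounded support makes exponential sums integrable and allows
  uniform approximation of continuous functions by them on \<open>cball 0 \<rho>\<close>.\<close>

lemma finite_rotation_invariant_eqI:
  fixes M N :: "(real^'n) measure"
  assumes card: "CARD('n) \<ge> 2"
    and M: "rotation_invariant M" "sets M = sets borel" "finite_measure M"
    and N: "rotation_invariant N" "sets N = sets borel" "finite_measure N"
    and supp: "AE x in M. norm x \<le> \<rho>" "AE x in N. norm x \<le> \<rho>"
    and ball: "\<And>r. emeasure M (ball 0 r) = emeasure N (ball 0 r)"
  shows "M = N"
proof -
  interpret M: finite_measure M by fact
  interpret N: finite_measure N by fact
  note [measurable_cong] = M(2) N(2)
  have sp: "space M = UNIV" "space N = UNIV"
    using sets_eq_imp_space_eq[OF M(2)] sets_eq_imp_space_eq[OF N(2)] by simp_all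
  have inter: "{..<a} \<inter> {..<b} = {..<min a b}" for a b :: real by auto
  have radial: "distr M borel norm = distr N borel norm"
  proof (rule measure_eqI_generator_eq[where E="range lessThan" and \<Omega>=UNIV and A="\<lambda>i. {..<real i}"])
    fix X :: "real set" assume "X \<in> range lessThan"
    then obtain r where X: "X = {..<r}" by auto
    have "norm -` {..<r} = ball (0::real^'n) r" by auto
    then show "emeasure (distr M borel norm) X = emeasure (distr N borel norm) X"
      using ball[of r] by (simp add: X emeasure_distr sp)
  next
    fix i :: nat
    show "emeasure (distr M borel norm) {..<real i} \<noteq> \<infinity>"
      by (simp add: emeasure_distr M.emeasure_eq_measure)
  qed (auto simp: Int_stable_def inter borel_Iio reals_Archimedean2)
  have bounded: "integrable K f" if K: "finite_measure K" "sets K = sets borel" "AE x in K. norm x \<le> \<rho>"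
    and f: "continuous_on UNIV f" for K :: "(real^'n) measure" and f :: "_ \<Rightarrow> real"
  proof -
    interpret K: finite_measure K by fact
    note [measurable_cong] = K(2)
    have "bounded (f ` cball 0 \<rho>)"
      by (intro compact_imp_bounded compact_continuous_image continuous_on_subset[OF f]) auto
    then obtain B where B: "\<And>x. norm x \<le> \<rho> \<Longrightarrow> norm (f x) \<le> B"
      unfolding bounded_iff by (metis dist_0_norm imageI mem_cball)
    have [measurable]: "f \<in> borel_measurable borel" using f by (rule borel_measurable_continuous_onI)
    show ?thesis
      by (rule K.integrable_const_bound[where B=B]) (use K(3) B in auto)
  qed
  let ?D = "emeasure lborel (ball (0::real^'n) 1)"
  have D: "?D \<noteq> 0" "?D \<noteq> top"
    by (auto simp: emeasure_ball less_imp_neq[OF unit_ball_vol_pos, symmetric])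
  have nn: "(\<integral>\<^sup>+x. ennreal (exp (\<xi> \<bullet> x)) \<partial>M) = (\<integral>\<^sup>+x. ennreal (exp (\<xi> \<bullet> x)) \<partial>N)" for \<xi>
  proof -
    have "?D * (\<integral>\<^sup>+x. ennreal (exp (\<xi> \<bullet> x)) \<partial>M) = ?D * (\<integral>\<^sup>+x. ennreal (exp (\<xi> \<bullet> x)) \<partial>N)"
      using nn_integral_exp_rotation_invariant[OF card M, of \<xi>]
        nn_integral_exp_rotation_invariant[OF card N, of \<xi>]
      unfolding radial by (simp only: mult.commute[of ?D])
    with D show ?thesis by (simp only: ennreal_mult_cancel_left) simp
  qed
  have span: "integral\<^sup>L M f = integral\<^sup>L N f" if "f \<in> exp_span" for f
    using that
  proof induction
    case (exp c \<xi>)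
    have "integral\<^sup>L M (\<lambda>x. exp (\<xi> \<bullet> x)) = integral\<^sup>L N (\<lambda>x. exp (\<xi> \<bullet> x))"
      by (subst (1 2) integral_eq_nn_integral) (auto simp: nn)
    then show ?case by simp
  next
    case (add f g)
    have "integrable M f" "integrable M g" "integrable N f" "integrable N g"
      using add bounded M N supp exp_span_continuous by blast+
    then show ?case using add by simp
  qed
  show ?thesis
  proof (rule finite_measure_eqI_continuous[OF M(2) N(2) M(3) N(3)])
    fix f :: "real^'n \<Rightarrow> real" assume f: "continuous_on UNIV f"
    have "\<bar>integral\<^sup>L M f - integral\<^sup>L N f\<bar> \<le> \<epsilon> * (measure M UNIV + measure N UNIV)" if eps: "\<epsilon> > 0" for \<epsilon>
    proof -
      obtain g where g: "g \<in> exp_span" "\<And>x. norm x \<le> \<rho> \<Longrightarrow> \<bar>f x - g x\<bar> < \<epsilon>"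
        using exp_span_approx[OF compact_cball continuous_on_subset[OF f subset_UNIV] eps, of 0 \<rho>]
        by (metis dist_0_norm mem_cball)
      have *: "\<bar>integral\<^sup>L K f - integral\<^sup>L K g\<bar> \<le> \<epsilon> * measure K UNIV"
        if K: "finite_measure K" "sets K = sets borel" "AE x in K. norm x \<le> \<rho>" for K
      proof -
        interpret K: finite_measure K by fact
        have spK: "space K = UNIV" using sets_eq_imp_space_eq[OF K(2)] by simp
        have int: "integrable K f" "integrable K g"
          using bounded[OF K] f exp_span_continuous[OF g(1)] by blast+
        have "\<bar>integral\<^sup>L K f - integral\<^sup>L K g\<bar> = \<bar>integral\<^sup>L K (\<lambda>x. f x - g x)\<bar>"
          using int by simp
        also have "\<dots> \<le> integral\<^sup>L K (\<lambda>x. \<bar>f x - g x\<bar>)"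
          by (rule integral_abs_bound)
        also have "\<dots> \<le> integral\<^sup>L K (\<lambda>x. \<epsilon>)"
          using K(3) int g(2) by (intro integral_mono_AE) (auto elim!: eventually_mono intro: less_imp_le)
        finally show ?thesis using spK by (simp add: mult.commute)
      qed
      show ?thesis
        using *[OF M(3,2) supp(1)] *[OF N(3,2) supp(2)] span[OF g(1)] by (simp add: distrib_left)
    qed
    \<comment> \<open>The denominator \<open>c + 1\<close> also covers \<open>c = 0\<close>.\<close>
    moreover have "\<exists>\<epsilon>>0. \<epsilon> * c < d" if "c \<ge> 0" "d > 0" for c d :: real
      using that by (intro exI[of _ "d / (c + 1)"]) (auto simp: field_simps)
    ultimately show "integral\<^sup>L M f = integral\<^sup>L N f"
      by (metis (no_types, opaque_lifting) add_nonneg_nonneg measure_nonneg not_le right_minus_eq zero_less_abs_iff)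
  qed
qed

section \<open>Localization to measures on an open ball\<close>

lemma sets_restrict_ball:
  assumes "sets M = sets (restrict_space borel (ball (0::'a::euclidean_space) R))"
  shows "B \<in> sets M \<longleftrightarrow> B \<in> sets borel \<and> B \<subseteq> ball 0 R" and "space M = ball 0 R"
  using assms sets_eq_imp_space_eq[OF assms]
  by (auto simp: sets_restrict_space_iff space_restrict_space)

lemma emeasure_ball_exhaustion:
  assumes s: "sets M = sets (restrict_space borel (ball (0::'a::euclidean_space) R))"
    and B: "B \<in> sets M" and R: "R > 0"
  shows "(\<lambda>j. emeasure M (B \<inter> ball 0 (R - R / (real j + 2)))) \<longlonglongrightarrow> emeasure M B"
proof -
  \<comment> \<open>The radii increase to \<open>R\<close>; the offset 2 makes the initial one
    \<open>R / 2\<close>, so all of them are positive.\<close>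
  define \<rho> where "\<rho> j = R - R / (real j + 2)" for j :: nat
  have mono: "\<rho> i \<le> \<rho> j" if "i \<le> j" for i j
    using that R by (auto simp: \<rho>_def intro!: divide_left_mono)
  have "(\<lambda>j. emeasure M (B \<inter> ball 0 (\<rho> j))) \<longlonglongrightarrow> emeasure M (\<Union>j. B \<inter> ball 0 (\<rho> j))"
  proof (rule Lim_emeasure_incseq)
    show "range (\<lambda>j. B \<inter> ball 0 (\<rho> j)) \<subseteq> sets M"
      using B by (auto simp: sets_restrict_ball(1)[OF s])
    show "incseq (\<lambda>j. B \<inter> ball 0 (\<rho> j))"
      using mono by (force simp: incseq_def)
  qed
  moreover have "(\<Union>j. B \<inter> ball 0 (\<rho> j)) = B"
  proof -
    have "\<exists>j. norm x < \<rho> j" if "x \<in> B" for x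
    proof -
      have x: "norm x < R" using that B by (auto simp: sets_restrict_ball(1)[OF s])
      obtain j :: nat where "R / (R - norm x) < real j" using reals_Archimedean2 by blast
      then have "R < (R - norm x) * (real j + 2)"
        using x by (simp add: pos_divide_less_eq mult.commute) (simp add: algebra_simps)
      then show ?thesis using x unfolding \<rho>_def by (intro exI[of _ j]) (simp add: field_simps)
    qed
    then show ?thesis by auto
  qed
  ultimately show ?thesis by (simp add: \<rho>_def)
qed

text \<open>The measures may be infinite near the boundary sphere. They are compared on each smaller
  ball, where they are finite, and the result passes to the limit along an exhaustion.\<close>

lemma rotation_invariant_eqI:
  fixes M N :: "(real^'n) measure"
  assumes card: "CARD('n) \<ge> 2" and R: "R > 0"
    and M: "rotation_invariant M" "sets M = sets (restrict_space borel (ball 0 R))"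
    and N: "rotation_invariant N" "sets N = sets (restrict_space borel (ball 0 R))"
    and ball: "\<And>r. 0 < r \<Longrightarrow> r < R \<Longrightarrow> emeasure M (ball 0 r) = emeasure N (ball 0 r)"
    and fin: "\<And>r. 0 < r \<Longrightarrow> r < R \<Longrightarrow> emeasure M (ball 0 r) < \<infinity>"
  shows "M = N"
proof (rule measure_eqI)
  note sM = sets_restrict_ball[OF M(2)] and sN = sets_restrict_ball[OF N(2)]
  have local: "emeasure M (B \<inter> ball 0 \<rho>) = emeasure N (B \<inter> ball 0 \<rho>)"
    if \<rho>: "0 < \<rho>" "\<rho> < R" and B: "B \<in> sets borel" for \<rho> B
  proof -
    \<comment> \<open>The trace of \<open>K\<close> on the smaller ball, regarded as a measure on
      the whole space; the identity in \<open>distr\<close> only changes the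
      \<sigma>-algebra.\<close>
    define loc :: "(real^'n) measure \<Rightarrow> (real^'n) measure"
      where "loc K = distr (restrict_space K (ball 0 \<rho>)) borel (\<lambda>x. x)" for K
    have e: "emeasure (loc K) A = emeasure K (A \<inter> ball 0 \<rho>)"
      if K: "sets K = sets (restrict_space borel (ball 0 R))" and A: "A \<in> sets borel" for K A
    proof -
      note sK = sets_restrict_ball[OF K]
      have sub: "ball (0::real^'n) \<rho> \<subseteq> ball 0 R" using \<rho> by auto
      then have bK: "ball 0 \<rho> \<inter> space K \<in> sets K" by (simp add: sK Int_absorb2)
      have [measurable]: "(\<lambda>x. x) \<in> measurable K borel"
        by (rule measurableI) (auto simp: sK)
      have "(\<lambda>x. x) \<in> measurable (restrict_space K (ball 0 \<rho>)) borel"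
        by (rule measurable_restrict_space1) measurable
      then have "emeasure (loc K) A = emeasure (restrict_space K (ball 0 \<rho>)) (A \<inter> ball 0 \<rho>)"
        using sub by (simp add: loc_def emeasure_distr A space_restrict_space sK) (simp add: Int_absorb2)
      also have "\<dots> = emeasure K (A \<inter> ball 0 \<rho>)"
        by (rule emeasure_restrict_space[OF bK]) simp
      finally show ?thesis .
    qed
    have props: "rotation_invariant (loc K)" "sets (loc K) = sets borel" "finite_measure (loc K)"
      "AE x in loc K. norm x \<le> \<rho>"
      if K: "sets K = sets (restrict_space borel (ball 0 R))" "rotation_invariant K"
        "emeasure K (ball 0 \<rho>) < \<infinity>" for K
    proof -
      note sK = sets_restrict_ball[OF K(1)]
      show s: "sets (loc K) = sets borel" by (simp add: loc_def)
      show "rotation_invariant (loc K)"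
        unfolding rotation_invariant_def s
      proof (intro allI ballI impI)
        fix Q :: "real^'n^'n" and B :: "(real^'n) set"
        assume B: "B \<in> sets borel" and Q: "rotation_matrix Q"
        have "emeasure (loc K) ((*v) Q ` B) = emeasure K ((*v) Q ` B \<inter> ball 0 \<rho>)"
          by (intro e K borel_rotation_image Q B)
        also have "(*v) Q ` B \<inter> ball 0 \<rho> = (*v) Q ` (B \<inter> ball 0 \<rho>)"
          using norm_rotation[OF Q] by auto
        also have "emeasure K \<dots> = emeasure K (B \<inter> ball 0 \<rho>)"
        proof -
          have "B \<inter> ball 0 \<rho> \<in> sets K" using B \<rho> by (auto simp: sK)
          then show ?thesis using K(2) Q unfolding rotation_invariant_def by blast
        qed
        finally show "emeasure (loc K) ((*v) Q ` B) = emeasure (loc K) B"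
          by (simp add: e K B)
      qed
      show "finite_measure (loc K)"
        by (rule finite_measureI) (use K(3) in \<open>simp add: loc_def[of K, THEN arg_cong[where f=space]] e[OF K(1)]\<close>)
      have "- cball 0 \<rho> \<inter> ball 0 \<rho> = ({} :: (real^'n) set)" by auto
      then have "- cball 0 \<rho> \<in> null_sets (loc K)"
        by (simp add: null_sets_def s e[OF K(1)] borel_comp)
      then show "AE x in loc K. norm x \<le> \<rho>"
        by (rule AE_I'[where N="- cball 0 \<rho>"]) auto
    qed
    have "loc M = loc N"
    proof (rule finite_rotation_invariant_eqI[OF card, where \<rho>=\<rho>])
      fix r :: real
      show "emeasure (loc M) (ball 0 r) = emeasure (loc N) (ball 0 r)"
      proof (cases "r > 0")
        case True
        have "ball 0 r \<inter> ball 0 \<rho> = ball (0::real^'n) (min r \<rho>)" by auto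
        then show ?thesis using ball[of "min r \<rho>"] True \<rho> by (simp add: e M N)
      qed (simp add: ball_empty)
    qed (use props[OF M(2,1)] props[OF N(2,1)] fin[OF \<rho>] ball[OF \<rho>] in auto)
    then show ?thesis using e[OF M(2) B] e[OF N(2) B] by simp
  qed
  fix B assume B: "B \<in> sets M"
  have "(\<lambda>j. emeasure M (B \<inter> ball 0 (R - R / (real j + 2)))) =
        (\<lambda>j. emeasure N (B \<inter> ball 0 (R - R / (real j + 2))))"
  proof
    fix j :: nat
    have "R / (real j + 2) < R / 1"
      using R by (intro divide_strict_left_mono) auto
    then have "0 < R - R / (real j + 2)" "R - R / (real j + 2) < R"
      using R by simp_all
    then show "emeasure M (B \<inter> ball 0 (R - R / (real j + 2))) = emeasure N (B \<inter> ball 0 (R - R / (real j + 2)))"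
      using local B by (simp add: sM)
  qed
  then show "emeasure M B = emeasure N B"
    using emeasure_ball_exhaustion[OF M(2) B R] emeasure_ball_exhaustion[OF N(2) _ R, of B] B
    by (simp add: sM sN LIMSEQ_unique)
qed (simp add: M N)

section \<open>Radial pushforwards of Lebesgue measure\<close>

text \<open>\<open>V r\<close> plays the role of the radius of the ball that is mapped onto
  \<open>ball 0 r\<close>. Left continuity reflects that \<open>ball 0 r\<close> is the union of the
  smaller concentric balls.\<close>

definition left_cont_mono :: "real \<Rightarrow> (real \<Rightarrow> real) \<Rightarrow> bool"
  where "left_cont_mono R V \<longleftrightarrow> (\<forall>r\<in>{0<..<R}. 0 \<le> V r) \<and> mono_on {0<..<R} V \<and>
    (\<forall>r\<in>{0<..<R}. (V \<longlongrightarrow> V r) (at_left r))"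

lemma left_cont_monoD:
  assumes "left_cont_mono R V"
  shows "0 < r \<Longrightarrow> r < R \<Longrightarrow> 0 \<le> V r" and "mono_on {0<..<R} V"
    and "0 < r \<Longrightarrow> r < R \<Longrightarrow> (V \<longlongrightarrow> V r) (at_left r)"
  using assms unfolding left_cont_mono_def by simp_all

lemma left_cont_mono_less:
  assumes "left_cont_mono R V" "0 < r" "r < R" "\<rho> < V r"
  shows "\<exists>s. 0 < s \<and> s < r \<and> \<rho> < V s"
proof -
  have "(V \<longlongrightarrow> V r) (at_left r)" by (rule left_cont_monoD(3)[OF assms(1-3)])
  then have "eventually (\<lambda>s. \<rho> < V s) (at_left r)" using assms(4) by (rule order_tendstoD)
  moreover have "eventually (\<lambda>s. s \<in> {0<..<r}) (at_left r)"
    using assms(2) by (rule eventually_at_leftI[where a=0, rotated]) simp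
  ultimately have "eventually (\<lambda>s. 0 < s \<and> s < r \<and> \<rho> < V s) (at_left r)"
    by eventually_elim auto
  then show ?thesis
    by (rule eventually_happens'[OF trivial_limit_at_left_real])
qed

text \<open>The infimum is taken over a nonempty set only if \<open>\<rho>\<close> lies below some value of \<open>V\<close>; this is why
  \<open>radial_map\<close> is restricted to \<open>radial_domain\<close> below.\<close>

definition radial_inverse :: "real \<Rightarrow> (real \<Rightarrow> real) \<Rightarrow> real \<Rightarrow> real"
  where "radial_inverse R V \<rho> = Inf {r \<in> {0<..<R}. \<rho> < V r}"

definition radial_domain :: "real \<Rightarrow> (real \<Rightarrow> real) \<Rightarrow> 'a::euclidean_space set"
  where "radial_domain R V = {y. \<exists>r\<in>{0<..<R}. norm y < V r}"

definition radial_map :: "real \<Rightarrow> (real \<Rightarrow> real) \<Rightarrow> 'a::euclidean_space \<Rightarrow> 'a"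
  where "radial_map R V y = radial_inverse R V (norm y) *\<^sub>R sgn y"

text \<open>This realizes a rotation invariant measure from the masses of centred balls:
  \<open>ball 0 r\<close> receives the volume of a ball of radius \<open>V r\<close>. A positive
  limit of \<open>V\<close> at 0 becomes a point mass at the origin.\<close>

definition radial_measure :: "real \<Rightarrow> (real \<Rightarrow> real) \<Rightarrow> 'a::euclidean_space measure"
  where "radial_measure R V = distr (restrict_space lborel (radial_domain R V))
    (restrict_space borel (ball 0 R)) (radial_map R V)"

text \<open>A Galois-type equivalence with strict inequalities. Left continuity enters from right to
  left: if \<open>norm y < V r\<close>, the same holds at some \<open>s < r\<close>, so the infimum
  lies strictly below \<open>r\<close>.\<close>

lemma radial_inverse_less_iff:
  assumes V: "left_cont_mono R V" and y: "y \<in> radial_domain R V" and r: "0 < r" "r < R"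
  shows "radial_inverse R V (norm y) < r \<longleftrightarrow> norm y < V r"
proof -
  let ?A = "{r \<in> {0<..<R}. norm y < V r}"
  have ne: "?A \<noteq> {}" using y unfolding radial_domain_def by blast
  have bdd: "bdd_below ?A" by (rule bdd_belowI[of _ 0]) auto
  have "(\<exists>s\<in>?A. s < r) \<longleftrightarrow> norm y < V r"
  proof
    assume "\<exists>s\<in>?A. s < r"
    then obtain s where s: "s \<in> {0<..<R}" "norm y < V s" "s < r" by blast
    from mono_onD[OF left_cont_monoD(2)[OF V]] have "V s \<le> V r" using s r by simp
    then show "norm y < V r" using s(2) by simp
  next
    assume "norm y < V r"
    then obtain s where "0 < s" "s < r" "norm y < V s"
      using left_cont_mono_less[OF V r] by blast
    then show "\<exists>s\<in>?A. s < r" using r by (intro bexI[of _ s]) auto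
  qed
  then show ?thesis unfolding radial_inverse_def cInf_less_iff[OF ne bdd] .
qed

lemma radial_inverse_bounds:
  assumes y: "y \<in> radial_domain R V"
  shows "0 \<le> radial_inverse R V (norm y)" "radial_inverse R V (norm y) < R"
proof -
  let ?A = "{r \<in> {0<..<R}. norm y < V r}"
  have ne: "?A \<noteq> {}" using y unfolding radial_domain_def by blast
  have bdd: "bdd_below ?A" by (rule bdd_belowI[of _ 0]) auto
  show "0 \<le> radial_inverse R V (norm y)"
    unfolding radial_inverse_def by (rule cInf_greatest[OF ne]) auto
  obtain r where r: "r \<in> ?A" using ne by blast
  then have "radial_inverse R V (norm y) \<le> r"
    unfolding radial_inverse_def by (rule cInf_lower[OF _ bdd])
  with r show "radial_inverse R V (norm y) < R" by simp
qed

text \<open>The origin is exceptional: if \<open>V\<close> vanishes on an initial interval, the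
  inverse at 0 is positive, yet \<open>sgn 0 = 0\<close> sends the origin to itself.\<close>

lemma norm_radial_map:
  assumes "y \<in> radial_domain R V"
  shows "norm (radial_map R V y) = (if y = 0 then 0 else radial_inverse R V (norm y))"
    and "radial_map R V y \<in> ball 0 R"
proof -
  show 1: "norm (radial_map R V y) = (if y = 0 then 0 else radial_inverse R V (norm y))"
    unfolding radial_map_def norm_scaleR norm_sgn
    using radial_inverse_bounds(1)[OF assms] by simp
  then show "radial_map R V y \<in> ball 0 R"
    using radial_inverse_bounds[OF assms] by auto
qed

lemma open_radial_domain: "open (radial_domain R V :: 'a::euclidean_space set)"
proof -
  have "(radial_domain R V :: 'a set) = (\<Union>r\<in>{0<..<R}. ball 0 (V r))"
    unfolding radial_domain_def set_eq_iff by simp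
  then show ?thesis by auto
qed

lemma borel_radial_domain [measurable]: "radial_domain R V \<in> sets borel"
  by (rule borel_open[OF open_radial_domain])

lemma measurable_radial_map:
  assumes V: "left_cont_mono R V"
  shows "radial_map R V \<in> measurable (restrict_space lborel (radial_domain R V))
    (restrict_space borel (ball (0::'a::euclidean_space) R))"
proof (rule measurable_restrict_space2)
  let ?E = "radial_domain R V :: 'a set"
  let ?L = "restrict_space lborel ?E"
  have sp: "space ?L = ?E" by (simp add: space_restrict_space)
  have sets: "S \<in> sets ?L" if "S \<in> sets borel" "S \<subseteq> ?E" for S
    using that by (subst sets_restrict_space_iff) auto
  have inv: "(\<lambda>y. radial_inverse R V (norm y)) \<in> borel_measurable ?L"
    unfolding borel_measurable_iff_less
  proof
    fix r
    consider "r \<le> 0" | "0 < r" "r < R" | "R \<le> r" by linarith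
    then have "{y \<in> ?E. radial_inverse R V (norm y) < r} \<in> sets ?L"
    proof cases
      case 1
      have "\<not> radial_inverse R V (norm y) < r" if "y \<in> ?E" for y
        using radial_inverse_bounds(1)[OF that] 1 by simp
      then have "{y \<in> ?E. radial_inverse R V (norm y) < r} = {}" by blast
      then show ?thesis by (simp only: sets.empty_sets)
    next
      case 2
      have sub: "ball 0 (V r) \<subseteq> ?E" using 2 by (auto simp: radial_domain_def)
      have "radial_inverse R V (norm y) < r \<longleftrightarrow> y \<in> ball 0 (V r)" if "y \<in> ?E" for y
        using radial_inverse_less_iff[OF V that 2] by simp
      with sub have "{y \<in> ?E. radial_inverse R V (norm y) < r} = ball 0 (V r)" by blast
      moreover note sub
      ultimately show ?thesis by (simp add: sets)
    next
      case 3
      have "radial_inverse R V (norm y) < r" if "y \<in> ?E" for y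
        using radial_inverse_bounds(2)[OF that] 3 by simp
      then have "{y \<in> ?E. radial_inverse R V (norm y) < r} = ?E" by blast
      then show ?thesis by (simp add: sets)
    qed
    then show "{y \<in> space ?L. radial_inverse R V (norm y) < r} \<in> sets ?L" by (simp add: sp)
  qed
  have "(sgn :: 'a \<Rightarrow> 'a) \<in> borel_measurable borel"
    unfolding sgn_div_norm by measurable
  then have "sgn \<in> borel_measurable ?L"
    by (intro measurable_restrict_space1) simp
  with inv show "radial_map R V \<in> borel_measurable ?L"
    unfolding radial_map_def by (rule borel_measurable_scaleR)
  show "radial_map R V \<in> space ?L \<rightarrow> ball 0 R"
    unfolding sp using norm_radial_map(2) by (rule Pi_I)
qed

lemma sets_radial_measure [simp]:
  "sets (radial_measure R V) = sets (restrict_space borel (ball 0 R))"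
  by (simp add: radial_measure_def)

lemma radial_map_preimage_borel:
  fixes B :: "'a::euclidean_space set"
  assumes "left_cont_mono R V" "B \<in> sets borel" "B \<subseteq> ball 0 R"
  shows "{y \<in> radial_domain R V. radial_map R V y \<in> B} \<in> sets borel"
proof -
  have "B \<in> sets (restrict_space borel (ball 0 R))"
    using assms by (simp add: sets_restrict_ball(1)[OF refl])
  from measurable_sets[OF measurable_radial_map[OF assms(1)] this]
  have "radial_map R V -` B \<inter> radial_domain R V \<in> sets (restrict_space lborel (radial_domain R V))"
    by (simp add: space_restrict_space)
  then have "radial_map R V -` B \<inter> radial_domain R V \<in> sets borel"
    by (subst (asm) sets_restrict_space_iff) auto
  moreover have "radial_map R V -` B \<inter> radial_domain R V = {y \<in> radial_domain R V. radial_map R V y \<in> B}"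
    by auto
  ultimately show ?thesis by simp
qed

lemma emeasure_radial_measure:
  fixes B :: "'a::euclidean_space set"
  assumes "left_cont_mono R V" "B \<in> sets borel" "B \<subseteq> ball 0 R"
  shows "emeasure (radial_measure R V) B = emeasure lborel {y \<in> radial_domain R V. radial_map R V y \<in> B}"
proof -
  have B: "B \<in> sets (restrict_space borel (ball 0 R))"
    using assms by (simp add: sets_restrict_ball(1)[OF refl])
  have "emeasure (radial_measure R V) B =
      emeasure (restrict_space lborel (radial_domain R V)) (radial_map R V -` B \<inter> radial_domain R V)"
    unfolding radial_measure_def
    by (subst emeasure_distr[OF measurable_radial_map[OF assms(1)] B]) (simp add: space_restrict_space)
  also have "\<dots> = emeasure lborel (radial_map R V -` B \<inter> radial_domain R V)"
    by (rule emeasure_restrict_space) auto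
  also have "radial_map R V -` B \<inter> radial_domain R V = {y \<in> radial_domain R V. radial_map R V y \<in> B}"
    by auto
  finally show ?thesis .
qed

lemma emeasure_radial_measure_ball:
  assumes V: "left_cont_mono R V" and r: "0 < r" "r < R"
  shows "emeasure (radial_measure R V) (ball (0::'a::euclidean_space) r) =
    ennreal (unit_ball_vol (DIM('a)) * V r ^ DIM('a))"
proof -
  have sub: "ball (0::'a) r \<subseteq> ball 0 R" using r by auto
  have "emeasure (radial_measure R V) (ball (0::'a) r) =
      emeasure lborel {y \<in> radial_domain R V. radial_map R V y \<in> ball (0::'a) r}"
    using V sub by (intro emeasure_radial_measure) auto
  also have "\<dots> = emeasure lborel (ball (0::'a) (V r))"
  proof (rule emeasure_eq_AE)
    \<comment> \<open>Away from the origin the preimage of \<open>ball 0 r\<close> is exactly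
      \<open>ball 0 (V r)\<close>. The origin may lie in the preimage although
      \<open>V r = 0\<close>.\<close>
    have "AE y in lborel. y \<noteq> (0::'a)" by (rule AE_lborel_singleton)
    then show "AE y in lborel. (y \<in> {y \<in> radial_domain R V. radial_map R V y \<in> ball 0 r}) \<longleftrightarrow>
        y \<in> ball (0::'a) (V r)"
    proof eventually_elim
      case (elim y)
      show ?case
      proof (cases "y \<in> radial_domain R V")
        case True
        then show ?thesis
          using elim norm_radial_map(1)[OF True] radial_inverse_less_iff[OF V True r] by simp
      next
        case False
        then show ?thesis using r by (auto simp: radial_domain_def)
      qed
    qed
    show "{y \<in> radial_domain R V. radial_map R V y \<in> ball (0::'a) r} \<in> sets lborel"
      using radial_map_preimage_borel[OF V _ sub] by simp
  qed simp
  also have "\<dots> = ennreal (unit_ball_vol (DIM('a)) * V r ^ DIM('a))"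
    by (intro emeasure_ball left_cont_monoD(1)[OF V r])
  finally show ?thesis .
qed

lemma rotation_invariant_radial_measure:
  assumes V: "left_cont_mono R V"
  shows "rotation_invariant (radial_measure R V :: (real^'n) measure)"
  unfolding rotation_invariant_def
proof (intro allI ballI impI)
  fix Q :: "real^'n^'n" and B :: "(real^'n) set"
  assume Q: "rotation_matrix Q" and "B \<in> sets (radial_measure R V)"
  then have B: "B \<in> sets borel" "B \<subseteq> ball 0 R"
    by (simp_all add: sets_restrict_ball(1)[OF refl])
  have QB: "(*v) Q ` B \<in> sets borel" "(*v) Q ` B \<subseteq> ball 0 R"
    using borel_rotation_image[OF Q B(1)] rotation_image_ball[OF Q, of R] B(2) by blast+
  have dom: "Q *v y \<in> radial_domain R V \<longleftrightarrow> y \<in> radial_domain R V" for y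
    by (simp add: radial_domain_def norm_rotation[OF Q])
  have map: "radial_map R V (Q *v y) = Q *v radial_map R V y" for y
    using norm_rotation[OF Q] by (simp add: radial_map_def sgn_div_norm linear_scale)
  have "{y \<in> radial_domain R V. radial_map R V y \<in> (*v) Q ` B} =
      (*v) Q ` {y \<in> radial_domain R V. radial_map R V y \<in> B}"
  proof -
    have "radial_map R V (Q *v y) \<in> (*v) Q ` B \<longleftrightarrow> radial_map R V y \<in> B" for y
      unfolding map using inj_rotation[OF Q] by (simp add: inj_image_mem_iff)
    note * = this
    show ?thesis
    proof (intro equalityI subsetI)
      fix z assume z: "z \<in> {y \<in> radial_domain R V. radial_map R V y \<in> (*v) Q ` B}"
      obtain y where y: "z = Q *v y" using surj_rotation[OF Q] by (meson surjD)
      have "y \<in> {y \<in> radial_domain R V. radial_map R V y \<in> B}"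
        using z unfolding y mem_Collect_eq dom * .
      then show "z \<in> (*v) Q ` {y \<in> radial_domain R V. radial_map R V y \<in> B}"
        unfolding y by (rule imageI)
    next
      fix z assume "z \<in> (*v) Q ` {y \<in> radial_domain R V. radial_map R V y \<in> B}"
      then obtain y where "z = Q *v y" "y \<in> radial_domain R V" "radial_map R V y \<in> B" by blast
      then show "z \<in> {y \<in> radial_domain R V. radial_map R V y \<in> (*v) Q ` B}"
        by (simp only: mem_Collect_eq dom * simp_thms)
    qed
  qed
  then show "emeasure (radial_measure R V) ((*v) Q ` B) = emeasure (radial_measure R V) B"
    using rotation_invariant_lborel[OF Q radial_map_preimage_borel[OF V B]]
    by (simp add: emeasure_radial_measure[OF V QB] emeasure_radial_measure[OF V B])
qed

section \<open>Subdifferentials of radial convex functions\<close>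

text \<open>Away from 0, \<open>w\<close> is the left derivative of \<open>\<phi>\<close>; the value \<open>w 0 = 0\<close> is a convention, chosen as a
  subgradient at 0 of the even extension of \<open>\<phi>\<close>.\<close>

definition slope_function :: "real \<Rightarrow> (real \<Rightarrow> real) \<Rightarrow> (real \<Rightarrow> real) \<Rightarrow> bool"
  where "slope_function R \<phi> w \<longleftrightarrow> w 0 = 0 \<and> mono_on {0..<R} w \<and>
    (\<forall>r\<in>{0<..<R}. (w \<longlongrightarrow> w r) (at_left r)) \<and>
    (\<forall>a b. 0 \<le> a \<and> a < b \<and> b < R \<longrightarrow> w a * (b - a) \<le> \<phi> b - \<phi> a \<and> \<phi> b - \<phi> a \<le> w b * (b - a))"

context
  fixes R :: real and \<phi> w :: "real \<Rightarrow> real"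
  assumes slope: "slope_function R \<phi> w"
begin

lemma slope_zero: "w 0 = 0"
  using slope unfolding slope_function_def by blast

lemma slope_mono: "0 \<le> a \<Longrightarrow> a \<le> b \<Longrightarrow> b < R \<Longrightarrow> w a \<le> w b"
proof -
  have "mono_on {0..<R} w" using slope unfolding slope_function_def by blast
  from mono_onD[OF this] show "0 \<le> a \<Longrightarrow> a \<le> b \<Longrightarrow> b < R \<Longrightarrow> w a \<le> w b" by simp
qed

lemma slope_nonneg: "0 \<le> r \<Longrightarrow> r < R \<Longrightarrow> 0 \<le> w r"
  using slope_mono[of 0 r] by (simp add: slope_zero)

lemma slope_bounds:
  assumes "0 \<le> a" "a < b" "b < R"
  shows "w a * (b - a) \<le> \<phi> b - \<phi> a" "\<phi> b - \<phi> a \<le> w b * (b - a)"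
  using slope assms unfolding slope_function_def by blast+

lemma slope_left_cont: "0 < r \<Longrightarrow> r < R \<Longrightarrow> (w \<longlongrightarrow> w r) (at_left r)"
  using slope unfolding slope_function_def by simp

lemma profile_mono:
  assumes "0 \<le> a" "a \<le> b" "b < R" shows "\<phi> a \<le> \<phi> b"
proof (cases "a = b")
  case False
  then have "w a * (b - a) \<le> \<phi> b - \<phi> a" using assms by (intro slope_bounds) auto
  moreover have "0 \<le> w a * (b - a)" using assms slope_nonneg[of a] by simp
  ultimately show ?thesis by simp
qed simp

lemma left_cont_mono_slope:
  assumes "a \<ge> 0" "t \<ge> 0"
  shows "left_cont_mono R (\<lambda>r. a * r + t * w r)"
  unfolding left_cont_mono_def
proof (intro conjI ballI)
  fix r assume r: "r \<in> {0<..<R}"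
  then show "0 \<le> a * r + t * w r" using assms slope_nonneg[of r] by simp
  show "((\<lambda>r. a * r + t * w r) \<longlongrightarrow> a * r + t * w r) (at_left r)"
    using r by (intro tendsto_intros slope_left_cont) auto
next
  show "mono_on {0<..<R} (\<lambda>r. a * r + t * w r)"
    using assms by (intro mono_onI add_mono mult_left_mono slope_mono) auto
qed

text \<open>\<open>q\<close> separates the left slopes before \<open>s\<close> from those after
  \<open>s\<close>, so it lies between the two one-sided derivatives at \<open>s\<close>. At jumps
  of \<open>w\<close> this supplies the whole interval of subgradients.\<close>

lemma profile_subgradient:
  assumes s: "0 \<le> s" "s < R" and q: "0 \<le> q"
    and lo: "\<And>r. 0 < r \<Longrightarrow> r < s \<Longrightarrow> w r \<le> q" and hi: "\<And>r. s < r \<Longrightarrow> r < R \<Longrightarrow> q \<le> w r"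
    and r: "0 \<le> r" "r < R"
  shows "\<phi> r \<ge> \<phi> s + q * (r - s)"
proof (cases r s rule: linorder_cases)
  case less
  have "w s \<le> q"
  proof (rule tendsto_upperbound[OF slope_left_cont])
    show "eventually (\<lambda>r. w r \<le> q) (at_left s)"
      using less r lo by (intro eventually_at_leftI[of 0]) auto
  qed (use s less r in auto)
  then have "w s * (s - r) \<le> q * (s - r)" using less by (intro mult_right_mono) auto
  then show ?thesis using slope_bounds(2)[of r s] less r s by (simp add: algebra_simps)
next
  case greater
  show ?thesis
  proof (cases "q = 0")
    case True
    then show ?thesis using profile_mono[of s r] greater s r by simp
  next
    case False
    with q have q: "q > 0" by simp
    \<comment> \<open>The slope bound is available only from points \<open>s' > s\<close>.
      Monotonicity replaces \<open>\<phi> s'\<close> by \<open>\<phi> s\<close>, and the inequality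
      is solved for \<open>s'\<close>, so letting \<open>s'\<close> decrease to \<open>s\<close>
      takes no continuity of \<open>\<phi>\<close>.\<close>
    have "r - (\<phi> r - \<phi> s) / q \<le> s"
    proof (rule dense_ge_bounded[OF greater])
      fix s' assume s': "s < s'" "s' < r"
      have "q * (r - s') \<le> w s' * (r - s')"
        using s' r hi[of s'] by (intro mult_right_mono) auto
      also have "\<dots> \<le> \<phi> r - \<phi> s'" using s' s r by (intro slope_bounds) auto
      also have "\<dots> \<le> \<phi> r - \<phi> s" using profile_mono[of s s'] s' s r by simp
      finally show "r - (\<phi> r - \<phi> s) / q \<le> s'" using q by (simp add: field_simps)
    qed
    then show ?thesis using q by (simp add: field_simps)
  qed
qed simp

lemma slope_is_subgradient:
  assumes "0 \<le> s" "s < R" "0 \<le> r" "r < R"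
  shows "\<phi> r \<ge> \<phi> s + w s * (r - s)"
  using assms by (intro profile_subgradient slope_mono slope_nonneg) auto

context
  fixes u :: "'a::euclidean_space \<Rightarrow> real"
  assumes u: "\<And>x. norm x < R \<Longrightarrow> u x = \<phi> (norm x)"
begin

text \<open>Since \<open>q\<close> is nonnegative, Cauchy-Schwarz reduces the inequality to the
  profile. At \<open>s = 0\<close> it holds for every direction \<open>v\<close>.\<close>

lemma radial_subgradient:
  assumes s: "0 \<le> s" "s < R" and q: "0 \<le> q" and v: "norm v = 1"
    and sub: "\<And>r. 0 \<le> r \<Longrightarrow> r < R \<Longrightarrow> \<phi> r \<ge> \<phi> s + q * (r - s)"
  shows "q *\<^sub>R v \<in> subdifferential (ball 0 R) u (s *\<^sub>R v)"
  unfolding subdifferential_def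
proof (intro CollectI ballI)
  fix z :: 'a assume "z \<in> ball 0 R"
  then have z: "norm z < R" by simp
  have "v \<bullet> v = 1" using v by (simp add: norm_eq_1)
  then have "(q *\<^sub>R v) \<bullet> (z - s *\<^sub>R v) = q * (v \<bullet> z - s)"
    by (simp add: inner_diff_right algebra_simps)
  also have "\<dots> \<le> q * (norm z - s)"
    using norm_cauchy_schwarz[of v z] v q by (intro mult_left_mono) auto
  finally show "u (s *\<^sub>R v) + (q *\<^sub>R v) \<bullet> (z - s *\<^sub>R v) \<le> u z"
    using sub[of "norm z"] z s v by (simp add: u)
qed

lemma slope_subgradient:
  assumes "norm x < R"
  shows "w (norm x) *\<^sub>R sgn x \<in> subdifferential (ball 0 R) u x"
proof (cases "x = 0")
  case True
  then show ?thesis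
    using assms profile_mono by (auto simp: subdifferential_def u)
next
  case False
  have "w (norm x) *\<^sub>R sgn x \<in> subdifferential (ball 0 R) u (norm x *\<^sub>R sgn x)"
    using assms False
    by (intro radial_subgradient slope_nonneg slope_is_subgradient) (auto simp: norm_sgn)
  then show ?thesis using False by (simp add: sgn_div_norm)
qed

text \<open>A function with a subgradient at every point is convex: average the supporting affine
  function at the intermediate point over the two endpoints.\<close>

lemma convex_radial: "convex_on (ball 0 R) u"
proof (rule convex_onI)
  fix t :: real and x y :: 'a
  assume t: "0 < t" "t < 1" and xy: "x \<in> ball 0 R" "y \<in> ball 0 R"
  define z where "z = (1 - t) *\<^sub>R x + t *\<^sub>R y"
  have z: "z \<in> ball 0 R"
    unfolding z_def using convexD_alt[OF convex_ball xy, of t] t by simp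
  define p where "p = w (norm z) *\<^sub>R sgn z"
  have "p \<in> subdifferential (ball 0 R) u z"
    using slope_subgradient[of z] z by (simp add: p_def)
  then have *: "u z + p \<bullet> (x - z) \<le> u x" "u z + p \<bullet> (y - z) \<le> u y"
    using xy by (auto simp: subdifferential_def)
  have "(1 - t) * (u z + p \<bullet> (x - z)) + t * (u z + p \<bullet> (y - z)) \<le> (1 - t) * u x + t * u y"
    using * t by (intro add_mono mult_left_mono) auto
  moreover have "(1 - t) * (u z + p \<bullet> (x - z)) + t * (u z + p \<bullet> (y - z)) = u z"
    by (simp add: z_def algebra_simps inner_simps)
  ultimately show "u ((1 - t) *\<^sub>R x + t *\<^sub>R y) \<le> (1 - t) * u x + t * u y"
    by (simp add: z_def)
qed simp

text \<open>Moving from \<open>x\<close> by \<open>r - norm x\<close> in the direction of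
  \<open>p\<close> stays in \<open>cball 0 r\<close>. On the way \<open>u\<close> grows by at least
  \<open>norm p\<close> times that length, and by at most \<open>w r\<close> times it.\<close>

lemma norm_subgradient_le:
  assumes x: "norm x < r" and r: "r < R" and p: "p \<in> subdifferential (ball 0 R) u x"
  shows "norm p \<le> w r"
proof (cases "p = 0")
  case True
  then show ?thesis using slope_nonneg[of r] x r norm_ge_zero[of x] by (simp del: norm_ge_zero)
next
  case False
  define z where "z = x + (r - norm x) *\<^sub>R sgn p"
  have "norm z \<le> norm x + norm ((r - norm x) *\<^sub>R sgn p)"
    unfolding z_def by (rule norm_triangle_ineq)
  also have "\<dots> = r" using x False by (simp add: norm_sgn)
  finally have z: "norm z \<le> r" .
  then have "u x + p \<bullet> (z - x) \<le> u z" using p r by (auto simp: subdifferential_def)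
  moreover have "p \<bullet> (z - x) = (r - norm x) * norm p"
    using False by (simp add: z_def sgn_div_norm power2_norm_eq_inner[symmetric] power2_eq_square)
  ultimately have "(r - norm x) * norm p \<le> u z - u x" by simp
  also have "\<dots> \<le> \<phi> r - \<phi> (norm x)"
    using z x r profile_mono[of "norm z" r] by (simp add: u)
  also have "\<dots> \<le> w r * (r - norm x)"
    using x r by (intro slope_bounds) auto
  finally show ?thesis using x by (simp add: mult.commute)
qed

text \<open>With \<open>s\<close> the radius of the image point, the required subgradient has length
  \<open>(norm y - s) / t\<close>. The definition of \<open>s\<close> as an infimum squeezes this
  quotient between the slopes before and after \<open>s\<close>.\<close>

lemma radial_map_subgradient:
  fixes y :: 'a
  assumes t: "t \<ge> 0" and V: "V = (\<lambda>r. r + t * w r)" and y: "y \<in> radial_domain R V"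
  shows "\<exists>p\<in>subdifferential (ball 0 R) u (radial_map R V y). y = radial_map R V y + t *\<^sub>R p"
proof -
  have lV: "left_cont_mono R V" using left_cont_mono_slope[of 1 t] t by (simp add: V)
  define s where "s = radial_inverse R V (norm y)"
  have s: "0 \<le> s" "s < R" unfolding s_def using radial_inverse_bounds[OF y] by auto
  have less: "s < r \<longleftrightarrow> norm y < r + t * w r" if "0 < r" "r < R" for r
    unfolding s_def using radial_inverse_less_iff[OF lV y that] by (simp add: V)
  \<comment> \<open>The first occurrence of the radius is pushed down to \<open>s\<close> while the
    slope is frozen at the larger value \<open>w r\<close>; no right continuity of \<open>w\<close>
    is available.\<close>
  have above: "norm y \<le> s + t * w r" if "s < r" "r < R" for r
  proof -
    have "norm y - t * w r \<le> s"
    proof (rule dense_ge_bounded[OF that(1)])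
      fix r' assume r': "s < r'" "r' < r"
      have "norm y < r' + t * w r'" using less[of r'] r' that s by simp
      also have "t * w r' \<le> t * w r" using r' that s t by (intro mult_left_mono slope_mono) auto
      finally show "norm y - t * w r \<le> r'" by simp
    qed
    then show ?thesis by simp
  qed
  have below: "s + t * w r \<le> norm y" if "0 \<le> r" "r < s" for r
  proof -
    have "s \<le> norm y - t * w r"
    proof (rule dense_le_bounded[OF that(2)])
      fix r' assume r': "r < r'" "r' < s"
      have "t * w r \<le> t * w r'" using r' that s t by (intro mult_left_mono slope_mono) auto
      also have "r' + t * w r' \<le> norm y" using less[of r'] r' that s by (simp add: not_less)
      finally show "r' \<le> norm y - t * w r" by simp
    qed
    then show ?thesis by simp
  qed
  \<comment> \<open>The convention \<open>w 0 = 0\<close> makes the subgradient length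
    nonnegative.\<close>
  have sy: "s \<le> norm y"
    using below[of 0] s by (cases "s = 0") (auto simp: slope_zero)
  \<comment> \<open>For \<open>y = 0\<close> the image point is the origin as well, so any direction
    works.\<close>
  obtain v :: 'a where v: "norm v = 1" "y = norm y *\<^sub>R v" "radial_map R V y = s *\<^sub>R v"
  proof (cases "y = 0")
    case True
    then have "s = 0" using sy s by simp
    obtain v :: 'a where "norm v = 1" by (rule vector_choose_size[of 1]) simp_all
    with that[of v] True \<open>s = 0\<close> show thesis by (simp add: radial_map_def)
  next
    case False
    then show thesis
      by (intro that[of "sgn y"]) (simp_all add: radial_map_def s_def norm_sgn sgn_div_norm)
  qed
  show ?thesis
  \<comment> \<open>No division by \<open>t\<close> is possible here, but the radial map is then the
    identity and any subgradient will do.\<close>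
  proof (cases "t = 0")
    case True
    have "norm y \<le> s"
    proof (rule dense_ge_bounded[OF s(2)])
      fix r assume "s < r" "r < R"
      then show "norm y \<le> r" using less[of r] s True by simp
    qed
    with sy have ys: "norm y = s" by simp
    then have "radial_map R V y = y" using v by simp
    moreover have "w (norm y) *\<^sub>R sgn y \<in> subdifferential (ball 0 R) u y"
      using s ys by (intro slope_subgradient) simp
    ultimately show ?thesis using True by auto
  next
    case False
    with t have t: "t > 0" by simp
    define q where "q = (norm y - s) / t"
    have q: "0 \<le> q" using sy t by (simp add: q_def)
    have "q *\<^sub>R v \<in> subdifferential (ball 0 R) u (s *\<^sub>R v)"
    proof (rule radial_subgradient[OF s q v(1)], rule profile_subgradient[OF s q])
      fix r assume "0 < r" "r < s"
      then show "w r \<le> q" using below[of r] t by (simp add: q_def field_simps)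
    next
      fix r assume "s < r" "r < R"
      then show "q \<le> w r" using above[of r] t by (simp add: q_def field_simps)
    qed
    moreover have "s *\<^sub>R v + t *\<^sub>R q *\<^sub>R v = y"
    proof -
      have "s + t * q = norm y" using t by (simp add: q_def)
      then show ?thesis by (subst v(2)) (simp only: scaleR_scaleR scaleR_add_left[symmetric])
    qed
    ultimately show ?thesis
      unfolding v(3) by (intro bexI[of _ "q *\<^sub>R v"]) (simp_all only: simp_thms)
  qed
qed

text \<open>An exact equality of sets, which also shows that the left side is Borel and its
  \<open>emeasure\<close> meaningful. The inclusion from left to right rests on injectivity:
  \<open>x + t *\<^sub>R p\<close> determines \<open>x\<close> because subdifferentials are
  monotone.\<close>

lemma subgradient_image_eq:
  assumes t: "t \<ge> 0" and V: "V = (\<lambda>r. r + t * w r)" and B: "B \<subseteq> ball 0 R"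
  shows "{x + t *\<^sub>R p | x p. x \<in> B \<and> p \<in> subdifferential (ball 0 R) u x} =
    {y \<in> radial_domain R V. radial_map R V y \<in> B}" (is "?L = ?R")
proof
  show "?R \<subseteq> ?L"
  proof
    fix y assume y: "y \<in> ?R"
    then obtain p where "p \<in> subdifferential (ball 0 R) u (radial_map R V y)"
      "y = radial_map R V y + t *\<^sub>R p"
      using radial_map_subgradient[OF t V] by blast
    with y show "y \<in> ?L" by blast
  qed
  show "?L \<subseteq> ?R"
  proof
    fix y assume "y \<in> ?L"
    then obtain x p where x: "x \<in> B" and p: "p \<in> subdifferential (ball 0 R) u x"
      and y: "y = x + t *\<^sub>R p" by auto
    have xR: "norm x < R" using x B by auto
    then obtain r where r: "norm x < r" "r < R" using dense by blast
    have "norm y \<le> norm x + t * norm p"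
      unfolding y using t norm_triangle_ineq[of x "t *\<^sub>R p"] by simp
    also have "\<dots> < r + t * w r"
      using norm_subgradient_le[OF r p] t r(1) by (intro add_less_le_mono mult_left_mono) auto
    finally have ydom: "y \<in> radial_domain R V"
      using r le_less_trans[OF norm_ge_zero r(1)] unfolding radial_domain_def V
      by (intro CollectI bexI[of _ r]) simp_all
    define x' where "x' = radial_map R V y"
    obtain p' where p': "p' \<in> subdifferential (ball 0 R) u x'" "y = x' + t *\<^sub>R p'"
      using radial_map_subgradient[OF t V ydom] unfolding x'_def by blast
    have x'R: "x' \<in> ball 0 R" unfolding x'_def by (rule norm_radial_map(2)[OF ydom])
    \<comment> \<open>Adding the two inequalities gives monotonicity, while \<open>x - x'\<close> is
      a nonpositive multiple of \<open>p - p'\<close>; together they force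
      \<open>x = x'\<close>.\<close>
    have "u x + p \<bullet> (x' - x) \<le> u x'" "u x' + p' \<bullet> (x - x') \<le> u x"
      using p p' x'R xR by (auto simp: subdifferential_def)
    then have mono: "0 \<le> (p - p') \<bullet> (x - x')"
      by (simp add: inner_diff_left inner_diff_right)
    have "x - x' = - (t *\<^sub>R (p - p'))"
      using y p'(2) by (simp add: algebra_simps)
    then have "(x - x') \<bullet> (x - x') = - t * ((p - p') \<bullet> (x - x'))"
      by (metis inner_minus_left inner_scaleR_left mult_minus_left)
    then have "(x - x') \<bullet> (x - x') \<le> 0" using mono t by (simp add: mult_nonneg_nonneg)
    then have "(x - x') \<bullet> (x - x') = 0" using inner_ge_zero antisym by blast
    then have "x' = x" by simp
    then show "y \<in> ?R" using x ydom by (simp add: x'_def)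
  qed
qed

end

end

section \<open>Profiles of radial convex functions\<close>

text \<open>The supremum of the slopes of chords ending at \<open>r\<close> is the left derivative;
  a chord to the right of \<open>r\<close> bounds it. Evenness makes 0 a minimum, so slopes are
  nonnegative. Left continuity holds because a supremum of continuous functions is lower
  semicontinuous and \<open>w\<close> is monotone.\<close>

lemma slope_function_of_convex:
  fixes \<phi> :: "real \<Rightarrow> real"
  assumes R: "R > 0" and conv: "convex_on {-R<..<R} \<phi>" and even: "\<And>r. \<bar>r\<bar> < R \<Longrightarrow> \<phi> (-r) = \<phi> r"
  obtains w where "slope_function R \<phi> w"
proof
  define sl where "sl s r = (\<phi> r - \<phi> s) / (r - s)" for s r
  define w where "w r = (if r \<le> 0 then 0 else SUP s\<in>{0..<r}. sl s r)" for r
  have chord: "sl s r \<le> sl r b" if "0 \<le> s" "s < r" "r < b" "b < R" for s r b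
  proof -
    have *: "(\<phi> s - \<phi> r) / (s - r) \<le> (\<phi> s - \<phi> b) / (s - b)"
      "(\<phi> s - \<phi> b) / (s - b) \<le> (\<phi> r - \<phi> b) / (r - b)"
      using convex_on_slope_le[OF conv, of s b r] that by force+
    have flip: "(x - y) / (z - w) = (y - x) / (w - z)" for x y z w :: real
      by (metis minus_diff_eq minus_divide_divide)
    show ?thesis
      using order_trans[OF *] unfolding sl_def flip[of "\<phi> s"] flip[of "\<phi> r" "\<phi> b"] .
  qed
  have zero_le: "\<phi> 0 \<le> \<phi> r" if "0 \<le> r" "r < R" for r
    using convex_onD[OF conv, of "1/2" "-r" r] that even[of r] by simp
  have sl0: "0 \<le> sl 0 r" if "0 < r" "r < R" for r
    using zero_le[of r] that by (simp add: sl_def)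
  have mono: "\<phi> a \<le> \<phi> b" if "0 \<le> a" "a < b" "b < R" for a b
  proof (cases "a = 0")
    case False
    have "0 \<le> sl a b" using sl0[of a] chord[of 0 a b] that False by simp
    then show ?thesis using that by (simp add: sl_def zero_le_divide_iff)
  qed (use zero_le that in simp)
  have bdd: "bdd_above ((\<lambda>s. sl s r) ` {0..<r})" if "0 < r" and rR: "r < R" for r
  proof -
    obtain b where "r < b" "b < R" using dense[OF rR] by blast
    then show ?thesis using chord by (intro bdd_aboveI[of _ "sl r b"]) auto
  qed
  have upper: "sl a b \<le> w b" if "0 \<le> a" "a < b" "b < R" for a b
    using that cSUP_upper[OF _ bdd[of b], of a] by (simp add: w_def)
  have lower: "w a \<le> sl a b" if "0 \<le> a" "a < b" "b < R" for a b
  proof (cases "a = 0")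
    case True
    then show ?thesis using sl0[of b] that by (simp add: w_def)
  next
    case False
    then have "(SUP s\<in>{0..<a}. sl s a) \<le> sl a b"
      using that chord by (intro cSUP_least) auto
    then show ?thesis using that False by (simp add: w_def)
  qed
  have w_mono: "w a \<le> w b" if "0 \<le> a" "a \<le> b" "b < R" for a b
    using lower[of a b] upper[of a b] that by (cases "a = b") auto
  have cont: "isCont \<phi> r" if "\<bar>r\<bar> < R" for r
    using convex_on_continuous[OF open_greaterThanLessThan conv] that
    by (simp add: continuous_on_eq_continuous_at abs_less_iff)
  have left_cont: "(w \<longlongrightarrow> w r) (at_left r)" if r: "0 < r" "r < R" for r
  proof (rule order_tendstoI)
    fix c assume "c < w r"
    then have "c < (SUP s\<in>{0..<r}. sl s r)" using r by (simp add: w_def)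
    then obtain s where s: "0 \<le> s" "s < r" "c < sl s r"
      using r by (subst (asm) less_cSUP_iff[OF _ bdd[OF r]]) auto
    have "((\<lambda>r. sl s r) \<longlongrightarrow> sl s r) (at_left r)"
      unfolding sl_def using cont[of r] r s
      by (intro tendsto_intros) (auto simp: isCont_def intro: tendsto_within_subset)
    from order_tendstoD(1)[OF this s(3)]
    have "eventually (\<lambda>r'. c < sl s r') (at_left r)" .
    moreover have "eventually (\<lambda>r'. r' \<in> {s<..<r}) (at_left r)"
      using s(2) by (rule eventually_at_leftI[where a=s, rotated]) simp
    ultimately show "eventually (\<lambda>r'. c < w r') (at_left r)"
    proof eventually_elim
      case (elim r')
      then show ?case using upper[of s r'] s r by simp
    qed
  next
    fix c assume c: "w r < c"
    show "eventually (\<lambda>r'. w r' < c) (at_left r)"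
    proof (rule eventually_at_leftI[of 0])
      fix r' assume "r' \<in> {0<..<r}"
      then show "w r' < c" using w_mono[of r' r] c r by simp
    qed (use r in simp)
  qed
  show "slope_function R \<phi> w"
    unfolding slope_function_def
  proof (intro conjI ballI allI impI)
    show "mono_on {0..<R} w" using w_mono by (intro mono_onI) auto
  next
    fix a b assume ab: "0 \<le> a \<and> a < b \<and> b < R"
    then show "w a * (b - a) \<le> \<phi> b - \<phi> a" "\<phi> b - \<phi> a \<le> w b * (b - a)"
      using lower[of a b] upper[of a b] by (simp_all add: sl_def field_simps)
  qed (use left_cont in \<open>simp_all add: w_def\<close>)
qed

text \<open>The restriction to a line through the origin is an even convex function on the symmetric
  interval.\<close>

lemma radial_convex_profile:
  fixes u :: "'a::euclidean_space \<Rightarrow> real"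
  assumes R: "R > 0" and conv: "convex_on (ball 0 R) u" and rad: "radially_symmetric_on (ball 0 R) u"
  obtains \<phi> w where "slope_function R \<phi> w" "\<And>x. norm x < R \<Longrightarrow> u x = \<phi> (norm x)"
proof -
  obtain e :: 'a where e: "norm e = 1" by (rule vector_choose_size[of 1]) simp_all
  define \<phi> where "\<phi> s = u (s *\<^sub>R e)" for s
  have u: "u x = \<phi> (norm x)" if "norm x < R" for x
    unfolding \<phi>_def using that e by (intro rad[unfolded radially_symmetric_on_def, rule_format]) auto
  have "convex_on {-R<..<R} \<phi>"
  proof (rule convex_onI)
    fix t x y :: real assume t: "0 < t" "t < 1" and xy: "x \<in> {-R<..<R}" "y \<in> {-R<..<R}"
    have "u ((1 - t) *\<^sub>R (x *\<^sub>R e) + t *\<^sub>R (y *\<^sub>R e)) \<le> (1 - t) * u (x *\<^sub>R e) + t * u (y *\<^sub>R e)"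
      using xy t e by (intro convex_onD[OF conv]) auto
    then show "\<phi> ((1 - t) *\<^sub>R x + t *\<^sub>R y) \<le> (1 - t) * \<phi> x + t * \<phi> y"
      by (simp add: \<phi>_def scaleR_add_left)
  qed simp
  moreover have "\<phi> (-r) = \<phi> r" if "\<bar>r\<bar> < R" for r
    unfolding \<phi>_def using that e by (intro rad[unfolded radially_symmetric_on_def, rule_format]) auto
  ultimately obtain w where "slope_function R \<phi> w"
    using slope_function_of_convex[OF R] by blast
  with u that show thesis by blast
qed

section \<open>Hessian measures of radial convex functions\<close>

text \<open>Makes the right side of the Steiner formula a measure, so that it can be compared with
  the left side through centred balls.\<close>

lemma linear_combination_of_measures:
  fixes M :: "'i \<Rightarrow> 'a measure" and c :: "'i \<Rightarrow> ennreal"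
  assumes sets: "\<And>i. i \<in> I \<Longrightarrow> sets (M i) = sets A"
  obtains N where "sets N = sets A" "\<And>B. B \<in> sets A \<Longrightarrow> emeasure N B = (\<Sum>i\<in>I. c i * emeasure (M i) B)"
proof
  define N where "N = measure_of (space A) (sets A) (\<lambda>B. \<Sum>i\<in>I. c i * emeasure (M i) B)"
  show "sets N = sets A" by (simp add: N_def sets.space_closed sets.sigma_sets_eq)
  fix B assume B: "B \<in> sets A"
  show "emeasure N B = (\<Sum>i\<in>I. c i * emeasure (M i) B)"
    unfolding N_def
  proof (rule emeasure_measure_of_sigma)
    show "sigma_algebra (space A) (sets A)" ..
    show "positive (sets A) (\<lambda>B. \<Sum>i\<in>I. c i * emeasure (M i) B)"
      by (simp add: positive_def)
    show "countably_additive (sets A) (\<lambda>B. \<Sum>i\<in>I. c i * emeasure (M i) B)"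
    proof (rule countably_additiveI)
      fix F :: "nat \<Rightarrow> 'a set" assume F: "range F \<subseteq> sets A" "disjoint_family F"
      have "(\<Sum>n. \<Sum>i\<in>I. c i * emeasure (M i) (F n)) = (\<Sum>i\<in>I. \<Sum>n. c i * emeasure (M i) (F n))"
        by (rule suminf_sum) (rule summableI)
      also have "\<dots> = (\<Sum>i\<in>I. c i * emeasure (M i) (\<Union>n. F n))"
        using F sets by (intro sum.cong) (simp_all add: suminf_emeasure)
      finally show "(\<Sum>n. \<Sum>i\<in>I. c i * emeasure (M i) (F n)) = (\<Sum>i\<in>I. c i * emeasure (M i) (\<Union>n. F n))" .
    qed
  qed (rule B)
qed

text \<open>The radius at which a ball has volume \<kappa>_n times the expression under the root,
  which is the mass required of \<open>ball 0 r\<close>.\<close>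

definition hessian_radius :: "nat \<Rightarrow> (real \<Rightarrow> real) \<Rightarrow> nat \<Rightarrow> real \<Rightarrow> real"
  where "hessian_radius n w k r = root n (real (n choose k) * r ^ (n - k) * w r ^ k)"

lemma left_cont_mono_hessian_radius:
  assumes slope: "slope_function R \<phi> w" and n: "n > 0"
  shows "left_cont_mono R (hessian_radius n w k)"
  unfolding left_cont_mono_def hessian_radius_def
proof (intro conjI ballI)
  note w = slope_nonneg[OF slope] slope_mono[OF slope]
  fix r assume r: "r \<in> {0<..<R}"
  then show "0 \<le> root n (real (n choose k) * r ^ (n - k) * w r ^ k)"
    using w(1)[of r] n by simp
  show "((\<lambda>r. root n (real (n choose k) * r ^ (n - k) * w r ^ k)) \<longlongrightarrow>
      root n (real (n choose k) * r ^ (n - k) * w r ^ k)) (at_left r)"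
    using r by (intro tendsto_intros slope_left_cont[OF slope]) auto
next
  note w = slope_nonneg[OF slope] slope_mono[OF slope]
  show "mono_on {0<..<R} (\<lambda>r. root n (real (n choose k) * r ^ (n - k) * w r ^ k))"
    using n w by (intro mono_onI real_root_le_mono mult_mono power_mono mult_nonneg_nonneg zero_le_power) auto
qed

lemma emeasure_hessian_radius_ball:
  fixes r R :: real
  assumes slope: "slope_function R \<phi> w" and r: "0 < r" "r < R"
  shows "emeasure (radial_measure R (hessian_radius (DIM('a)) w k)) (ball (0::'a::euclidean_space) r) =
    ennreal (unit_ball_vol (DIM('a)) * (real (DIM('a) choose k) * r ^ (DIM('a) - k) * w r ^ k))"
proof -
  have "0 \<le> real (DIM('a) choose k) * r ^ (DIM('a) - k) * w r ^ k"
    using r slope_nonneg[OF slope, of r] by simp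
  then show ?thesis
    using r by (subst emeasure_radial_measure_ball)
      (simp_all add: left_cont_mono_hessian_radius[OF slope] hessian_radius_def real_root_pow_pos2)
qed

lemma compact_subset_smaller_ball:
  assumes "compact K" "K \<subseteq> ball (0::'a::euclidean_space) R" "R > 0"
  obtains \<rho> where "0 < \<rho>" "\<rho> < R" "K \<subseteq> ball 0 \<rho>"
proof (cases "K = {}")
  case True
  then show ?thesis using that[of "R/2"] assms by simp
next
  case False
  obtain x where x: "x \<in> K" "\<And>y. y \<in> K \<Longrightarrow> norm y \<le> norm x"
    using continuous_attains_sup[OF assms(1) False continuous_on_norm_id] by auto
  have "norm x < R" using x(1) assms(2) by auto
  then obtain \<rho> where \<rho>: "norm x < \<rho>" "\<rho> < R" using dense by blast
  then show ?thesis
    using that[of \<rho>] x(2) le_less_trans[OF norm_ge_zero \<rho>(1)] by (fastforce intro: le_less_trans)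
qed

text \<open>Both sides of the Steiner formula are rotation invariant, so it suffices to compare them on
  centred balls, where the formula is the binomial theorem for \<open>(r + t * w r) ^ n\<close>.\<close>

lemma has_hessian_measures_radial:
  fixes u :: "real^'n \<Rightarrow> real"
  assumes card: "CARD('n) \<ge> 2" and R: "R > 0"
    and slope: "slope_function R \<phi> w" and u: "\<And>x. norm x < R \<Longrightarrow> u x = \<phi> (norm x)"
  shows "has_hessian_measures (ball 0 R) u (\<lambda>k. radial_measure R (hessian_radius CARD('n) w k))"
proof -
  define \<Phi> :: "nat \<Rightarrow> (real^'n) measure" where "\<Phi> k = radial_measure R (hessian_radius CARD('n) w k)" for k
  have ball: "emeasure (\<Phi> k) (ball 0 r) =
      ennreal (unit_ball_vol CARD('n) * (real (CARD('n) choose k) * r ^ (CARD('n) - k) * w r ^ k))"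
    if "0 < r" "r < R" for k r
    unfolding \<Phi>_def using emeasure_hessian_radius_ball[OF slope that, where 'a="real^'n"] by simp
  have lc: "left_cont_mono R (hessian_radius CARD('n) w k)" for k
    by (rule left_cont_mono_hessian_radius[OF slope]) simp
  have sets: "sets (\<Phi> k) = sets (restrict_space borel (ball 0 R))" for k
    by (simp add: \<Phi>_def)
  have "radon_measure_on (ball 0 R) (\<Phi> k)" for k
    unfolding radon_measure_on_def
  proof (intro conjI allI impI sets)
    fix K :: "(real^'n) set" assume K: "compact K \<and> K \<subseteq> ball 0 R"
    then obtain \<rho> where \<rho>: "0 < \<rho>" "\<rho> < R" "K \<subseteq> ball 0 \<rho>"
      using compact_subset_smaller_ball[OF _ _ R] by blast
    then have "ball 0 \<rho> \<in> sets (\<Phi> k)" by (auto simp: sets_restrict_ball(1)[OF sets])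
    then have "emeasure (\<Phi> k) K \<le> emeasure (\<Phi> k) (ball 0 \<rho>)"
      using \<rho>(3) by (intro emeasure_mono)
    also have "\<dots> < \<infinity>" using \<rho> by (simp add: ball)
    finally show "emeasure (\<Phi> k) K < \<infinity>" .
  qed
  moreover have "emeasure lborel {x + t *\<^sub>R p | x p. x \<in> B \<and> p \<in> subdifferential (ball 0 R) u x} =
      (\<Sum>k\<le>CARD('n). ennreal (t ^ k) * emeasure (\<Phi> k) B)"
    if t: "t \<ge> 0" and B: "B \<in> sets borel" "B \<subseteq> ball 0 R" for t B
  proof -
    define V where "V r = r + t * w r" for r
    have V: "V = (\<lambda>r. r + t * w r)" by (simp add: V_def fun_eq_iff)
    have lV: "left_cont_mono R V"
      using left_cont_mono_slope[OF slope, of 1 t] t by (simp add: V)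
    define M :: "(real^'n) measure" where "M = radial_measure R V"
    have sM: "sets M = sets (restrict_space borel (ball 0 R))" by (simp add: M_def)
    obtain N where N: "sets N = sets (restrict_space borel (ball (0::real^'n) R))"
      "\<And>B. B \<in> sets (restrict_space borel (ball (0::real^'n) R)) \<Longrightarrow>
        emeasure N B = (\<Sum>k\<le>CARD('n). ennreal (t ^ k) * emeasure (\<Phi> k) B)"
      using linear_combination_of_measures[where M=\<Phi> and c="\<lambda>k. ennreal (t ^ k)" and I="{..CARD('n)}", OF sets]
      by blast
    have M_ball: "emeasure M (ball 0 r) = ennreal (unit_ball_vol CARD('n) * V r ^ CARD('n))"
      if "0 < r" "r < R" for r
      unfolding M_def using emeasure_radial_measure_ball[OF lV that, where 'a="real^'n"] by simp
    have "M = N"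
    proof (rule rotation_invariant_eqI[OF card R _ sM _ N(1)])
      show "rotation_invariant M"
        unfolding M_def by (rule rotation_invariant_radial_measure[OF lV])
      show "rotation_invariant N"
        unfolding rotation_invariant_def
      proof (intro allI ballI impI)
        fix Q :: "real^'n^'n" and B assume B: "B \<in> sets N" and Q: "rotation_matrix Q"
        then have "B \<in> sets borel" "B \<subseteq> ball 0 R" by (simp_all add: sets_restrict_ball(1)[OF N(1)])
        then have "(*v) Q ` B \<in> sets N"
          using borel_rotation_image[OF Q, of B] rotation_image_ball[OF Q, of R]
          by (auto simp: sets_restrict_ball(1)[OF N(1)])
        moreover have "emeasure (\<Phi> k) ((*v) Q ` B) = emeasure (\<Phi> k) B" for k
          using rotation_invariant_radial_measure[OF lc[of k], where 'n='n] Q B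
          unfolding rotation_invariant_def \<Phi>_def by (simp add: N(1))
        ultimately show "emeasure N ((*v) Q ` B) = emeasure N B"
          using B unfolding N(1) by (simp add: N(2))
      qed
    next
      fix r assume r: "0 < r" "r < R"
      then show "emeasure M (ball 0 r) < \<infinity>" by (simp add: M_ball)
      have w: "0 \<le> w r" using slope_nonneg[OF slope] r by simp
      have "ball 0 r \<in> sets (restrict_space borel (ball (0::real^'n) R))"
        using r by (auto simp: sets_restrict_ball(1)[OF refl])
      then have "emeasure N (ball 0 r) = (\<Sum>k\<le>CARD('n). ennreal (t ^ k) *
          ennreal (unit_ball_vol CARD('n) * (real (CARD('n) choose k) * r ^ (CARD('n) - k) * w r ^ k)))"
        using r by (simp add: N(2) ball)
      also have "\<dots> = ennreal (\<Sum>k\<le>CARD('n). t ^ k *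
          (unit_ball_vol CARD('n) * (real (CARD('n) choose k) * r ^ (CARD('n) - k) * w r ^ k)))"
        using t r w by (subst sum_ennreal[symmetric]) (auto simp: ennreal_mult)
      \<comment> \<open>The binomial theorem for \<open>t * w r + r\<close>, the radius
        \<open>V r\<close> of the preimage ball.\<close>
      also have "(\<Sum>k\<le>CARD('n). t ^ k *
          (unit_ball_vol CARD('n) * (real (CARD('n) choose k) * r ^ (CARD('n) - k) * w r ^ k))) =
          unit_ball_vol CARD('n) * (t * w r + r) ^ CARD('n)"
        by (simp add: binomial_ring sum_distrib_left power_mult_distrib mult_ac)
      finally show "emeasure M (ball 0 r) = emeasure N (ball 0 r)"
        using r by (simp add: M_ball V_def add.commute)
    qed
    have "emeasure lborel {x + t *\<^sub>R p | x p. x \<in> B \<and> p \<in> subdifferential (ball 0 R) u x} = emeasure M B"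
      unfolding subgradient_image_eq[OF slope u t V B(2), simplified] M_def
      by (rule emeasure_radial_measure[OF lV B, symmetric])
    also have "\<dots> = (\<Sum>k\<le>CARD('n). ennreal (t ^ k) * emeasure (\<Phi> k) B)"
      unfolding \<open>M = N\<close> using B by (intro N(2)) (simp add: sets_restrict_ball(1)[OF refl])
    finally show ?thesis .
  qed
  ultimately show ?thesis
    unfolding has_hessian_measures_def \<Phi>_def by simp
qed

section \<open>Uniqueness and evaluation of the Hessian measures\<close>

lemma polynomial_coeffs_unique:
  fixes a b :: "nat \<Rightarrow> real"
  assumes "\<And>t. t \<ge> 0 \<Longrightarrow> (\<Sum>k\<le>n. t ^ k * a k) = (\<Sum>k\<le>n. t ^ k * b k)" and "k \<le> n"
  shows "a k = b k"
proof (rule ccontr)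
  assume "a k \<noteq> b k"
  then have "finite {t. (\<Sum>k\<le>n. (a k - b k) * t ^ k) = 0}"
    using Transcendental.polyfun_rootbound[of "\<lambda>k. a k - b k" k n] assms(2) by simp
  moreover have "(\<Sum>k\<le>n. (a k - b k) * t ^ k) = (\<Sum>k\<le>n. t ^ k * a k) - (\<Sum>k\<le>n. t ^ k * b k)" for t
    unfolding sum_subtractf[symmetric] by (intro sum.cong) (simp_all add: algebra_simps)
  then have "{0..} \<subseteq> {t. (\<Sum>k\<le>n. (a k - b k) * t ^ k) = 0}"
    using assms(1) by auto
  ultimately show False using infinite_Ici finite_subset by blast
qed

text \<open>For sets inside a smaller ball all masses are finite by the Radon property, so the
  Steiner formula is an identity of real polynomials on the half-line and its coefficients agree.
  Exhaustion extends this to all Borel subsets of the ball.\<close>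

lemma hessian_measures_unique:
  fixes u :: "'a::euclidean_space \<Rightarrow> real"
  assumes R: "R > 0" and \<Phi>: "has_hessian_measures (ball 0 R) u \<Phi>"
    and \<Psi>: "has_hessian_measures (ball 0 R) u \<Psi>" and k: "k \<le> DIM('a)"
  shows "\<Phi> k = \<Psi> k"
proof (rule measure_eqI)
  have sets: "sets (X j) = sets (restrict_space borel (ball 0 R))"
    if "has_hessian_measures (ball 0 R) u X" "j \<le> DIM('a)" for X j
    using that by (simp add: has_hessian_measures_def radon_measure_on_def)
  show "sets (\<Phi> k) = sets (\<Psi> k)" using sets \<Phi> \<Psi> k by simp
  have finite: "emeasure (X j) B = ennreal (measure (X j) B)"
    if X: "has_hessian_measures (ball 0 R) u X" and j: "j \<le> DIM('a)"
      and B: "B \<subseteq> ball 0 \<rho>" "\<rho> < R" for X j B \<rho>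
  proof -
    have sub: "cball (0::'a) \<rho> \<subseteq> ball 0 R" using B(2) by auto
    then have "emeasure (X j) B \<le> emeasure (X j) (cball 0 \<rho>)"
      using B(1) ball_subset_cball[of "0::'a" \<rho>]
      by (intro emeasure_mono) (auto simp: sets_restrict_ball(1)[OF sets[OF X j]])
    also have "\<dots> < \<infinity>"
      using X j sub by (simp add: has_hessian_measures_def radon_measure_on_def)
    finally show ?thesis by (intro emeasure_eq_ennreal_measure) simp
  qed
  have local: "emeasure (\<Phi> k) B = emeasure (\<Psi> k) B"
    if B: "B \<in> sets borel" "B \<subseteq> ball 0 \<rho>" "\<rho> < R" for B \<rho>
  proof -
    have BR: "B \<subseteq> ball 0 R" using B(2,3) by auto
    have steiner: "emeasure lborel {x + t *\<^sub>R p | x p. x \<in> B \<and> p \<in> subdifferential (ball 0 R) u x} =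
        ennreal (\<Sum>j\<le>DIM('a). t ^ j * measure (X j) B)"
      if X: "has_hessian_measures (ball 0 R) u X" and t: "t \<ge> 0" for X t
    proof -
      have "emeasure lborel {x + t *\<^sub>R p | x p. x \<in> B \<and> p \<in> subdifferential (ball 0 R) u x} =
          (\<Sum>j\<le>DIM('a). ennreal (t ^ j) * emeasure (X j) B)"
        using X t B(1) BR unfolding has_hessian_measures_def by blast
      also have "\<dots> = (\<Sum>j\<le>DIM('a). ennreal (t ^ j * measure (X j) B))"
        using t by (intro sum.cong) (simp_all add: finite[OF X _ B(2,3)] ennreal_mult)
      also have "\<dots> = ennreal (\<Sum>j\<le>DIM('a). t ^ j * measure (X j) B)"
        using t by (intro sum_ennreal) simp
      finally show ?thesis .
    qed
    have "measure (\<Phi> k) B = measure (\<Psi> k) B"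
    proof (rule polynomial_coeffs_unique[OF _ k])
      fix t :: real assume t: "t \<ge> 0"
      have "ennreal (\<Sum>j\<le>DIM('a). t ^ j * measure (\<Phi> j) B) = ennreal (\<Sum>j\<le>DIM('a). t ^ j * measure (\<Psi> j) B)"
        using steiner[OF \<Phi> t] steiner[OF \<Psi> t] by simp
      then show "(\<Sum>j\<le>DIM('a). t ^ j * measure (\<Phi> j) B) = (\<Sum>j\<le>DIM('a). t ^ j * measure (\<Psi> j) B)"
        using t by (subst (asm) ennreal_inj) (auto intro!: sum_nonneg)
    qed
    then show ?thesis using finite[OF \<Phi> k B(2,3)] finite[OF \<Psi> k B(2,3)] by simp
  qed
  fix B assume B: "B \<in> sets (\<Phi> k)"
  note s = sets[OF \<Phi> k] sets[OF \<Psi> k]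
  have "(\<lambda>j. emeasure (\<Phi> k) (B \<inter> ball 0 (R - R / (real j + 2)))) =
      (\<lambda>j. emeasure (\<Psi> k) (B \<inter> ball 0 (R - R / (real j + 2))))"
  proof
    fix j :: nat
    have "R - R / (real j + 2) < R" using R by simp
    then show "emeasure (\<Phi> k) (B \<inter> ball 0 (R - R / (real j + 2))) =
        emeasure (\<Psi> k) (B \<inter> ball 0 (R - R / (real j + 2)))"
      using B by (intro local) (auto simp: sets_restrict_ball(1)[OF s(1)])
  qed
  then show "emeasure (\<Phi> k) B = emeasure (\<Psi> k) B"
    using emeasure_ball_exhaustion[OF s(1) B R] emeasure_ball_exhaustion[OF s(2) _ R, of B] B
    by (simp add: s LIMSEQ_unique)
qed

lemma hessian_measure_radial:
  fixes u :: "real^'n \<Rightarrow> real"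
  assumes card: "CARD('n) \<ge> 2" and R: "R > 0"
    and slope: "slope_function R \<phi> w" and u: "\<And>x. norm x < R \<Longrightarrow> u x = \<phi> (norm x)"
    and k: "k \<le> CARD('n)"
  shows "hessian_measure (ball 0 R) k u = radial_measure R (hessian_radius CARD('n) w k)"
proof -
  have *: "has_hessian_measures (ball 0 R) u (\<lambda>k. radial_measure R (hessian_radius CARD('n) w k))"
    by (rule has_hessian_measures_radial[OF card R slope u])
  show ?thesis
    unfolding hessian_measure_def
  proof (rule the_equality)
    show "\<exists>\<Phi>. has_hessian_measures (ball 0 R) u \<Phi> \<and> radial_measure R (hessian_radius CARD('n) w k) = \<Phi> k"
      using * by blast
    fix M assume "\<exists>\<Phi>. has_hessian_measures (ball 0 R) u \<Phi> \<and> M = \<Phi> k"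
    then show "M = radial_measure R (hessian_radius CARD('n) w k)"
      using hessian_measures_unique[OF R _ *] k by auto
  qed
qed

section \<open>Solutions of the Hessian equation\<close>

text \<open>On a partition into \<open>Suc N\<close> equal pieces the increments of \<open>w\<close>
  telescope, leaving a bound of order \<open>1 / Suc N\<close>. This allows profiles with the same
  slope to be compared without derivatives, which may fail to exist where \<open>w\<close>
  jumps.\<close>

lemma eq_of_increment_le_slope:
  fixes D w :: "real \<Rightarrow> real"
  assumes ab: "a \<le> b"
    and bound: "\<And>x y. a \<le> x \<Longrightarrow> x < y \<Longrightarrow> y \<le> b \<Longrightarrow> \<bar>D y - D x\<bar> \<le> (w y - w x) * (y - x)"
  shows "D a = D b"
proof (cases "a = b")
  case False
  with ab have ab: "a < b" by simp
  have le: "\<bar>D b - D a\<bar> \<le> (w b - w a) * (b - a) / real (Suc N)" for N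
  proof -
    define h where "h = (b - a) / real (Suc N)"
    define x where "x i = a + real i * h" for i
    have h: "h > 0" using ab by (simp add: h_def)
    have xN: "x 0 = a" "x (Suc N) = b" by (simp_all add: x_def h_def)
    have step: "\<bar>D (x (Suc i)) - D (x i)\<bar> \<le> (w (x (Suc i)) - w (x i)) * h" if i: "i < Suc N" for i
    proof -
      have "real (Suc i) * h \<le> real (Suc N) * h" using i h by (intro mult_right_mono) auto
      then have "x (Suc i) \<le> b" using xN(2) by (simp add: x_def)
      moreover have "x (Suc i) - x i = h" by (simp add: x_def algebra_simps)
      ultimately show ?thesis
        using bound[of "x i" "x (Suc i)"] h by (simp add: x_def)
    qed
    have "\<bar>D b - D a\<bar> = \<bar>\<Sum>i<Suc N. D (x (Suc i)) - D (x i)\<bar>"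
      by (subst sum_lessThan_telescope) (simp add: xN)
    also have "\<dots> \<le> (\<Sum>i<Suc N. \<bar>D (x (Suc i)) - D (x i)\<bar>)" by (rule sum_abs)
    also have "\<dots> \<le> (\<Sum>i<Suc N. (w (x (Suc i)) - w (x i)) * h)"
      by (intro sum_mono step) simp
    also have "\<dots> = (w b - w a) * h"
      unfolding sum_distrib_right[symmetric] by (subst sum_lessThan_telescope) (simp add: xN)
    finally show ?thesis by (simp add: h_def)
  qed
  have "(\<lambda>N. (w b - w a) * (b - a) / real (Suc N)) \<longlonglongrightarrow> 0"
    by (rule LIMSEQ_Suc[OF lim_const_over_n])
  then have "\<bar>D b - D a\<bar> \<le> 0"
    by (rule LIMSEQ_le_const) (use le in blast)
  then show ?thesis by simp
qed simp

lemma integral_mono_on_bounds: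
  fixes h :: "real \<Rightarrow> real"
  assumes mono: "mono_on {0..R} h" and ab: "0 \<le> a" "a \<le> b" "b \<le> R"
  shows "h a * (b - a) \<le> integral {a..R} h - integral {b..R} h"
    and "integral {a..R} h - integral {b..R} h \<le> h b * (b - a)"
proof -
  have int: "h integrable_on {a..R}"
    using ab by (intro integrable_on_mono_on mono_on_subset[OF mono]) auto
  have "integral {a..R} h - integral {b..R} h = integral {a..b} h"
    using Henstock_Kurzweil_Integration.integral_combine[OF ab(2,3) int] by simp
  moreover have hab: "h integrable_on {a..b}"
    using ab by (intro integrable_on_mono_on mono_on_subset[OF mono]) auto
  have "integral {a..b} (\<lambda>_. h a) \<le> integral {a..b} h"
    using ab mono by (intro integral_le hab) (auto simp: mono_on_def)
  moreover have "integral {a..b} h \<le> integral {a..b} (\<lambda>_. h b)"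
    using ab mono by (intro integral_le hab) (auto simp: mono_on_def)
  ultimately show "h a * (b - a) \<le> integral {a..R} h - integral {b..R} h"
    "integral {a..R} h - integral {b..R} h \<le> h b * (b - a)"
    using ab by (simp_all add: mult.commute)
qed

lemma slope_function_integral:
  fixes h :: "real \<Rightarrow> real"
  assumes mono: "mono_on {0..R} h" and zero: "h 0 = 0"
    and lc: "\<And>r. 0 < r \<Longrightarrow> r < R \<Longrightarrow> (h \<longlongrightarrow> h r) (at_left r)"
  shows "slope_function R (\<lambda>r. - integral {r..R} h) h"
  unfolding slope_function_def
proof (intro conjI ballI allI impI)
  show "mono_on {0..<R} h" by (rule mono_on_subset[OF mono]) auto
next
  fix a b assume "0 \<le> a \<and> a < b \<and> b < R"
  then show "h a * (b - a) \<le> - integral {b..R} h - - integral {a..R} h"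
    "- integral {b..R} h - - integral {a..R} h \<le> h b * (b - a)"
    using integral_mono_on_bounds[OF mono, of a b] by simp_all
qed (use zero lc in auto)

text \<open>The increments of \<open>\<phi>\<close> and of minus the integral lie between the same
  bounds \<open>w x * (y - x)\<close> and \<open>w y * (y - x)\<close>. Hence their difference is
  constant, and the limit at \<open>R\<close> shows that the constant is 0.\<close>

lemma profile_eq_integral:
  fixes h :: "real \<Rightarrow> real"
  assumes slope: "slope_function R \<phi> w" and mono: "mono_on {0..R} h"
    and wh: "\<And>r. 0 \<le> r \<Longrightarrow> r < R \<Longrightarrow> w r = h r"
    and lim: "(\<phi> \<longlongrightarrow> 0) (at_left R)" and a: "0 \<le> a" "a < R"
  shows "\<phi> a = - integral {a..R} h"
proof -
  define D where "D r = \<phi> r + integral {r..R} h" for r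
  have const: "D a = D b" if b: "a < b" "b < R" for b
  proof (rule eq_of_increment_le_slope[where D=D and w=w])
    fix x y assume xy: "a \<le> x" "x < y" "y \<le> b"
    then have "w x * (y - x) \<le> \<phi> y - \<phi> x" "\<phi> y - \<phi> x \<le> w y * (y - x)"
      using a b by (auto intro!: slope_bounds[OF slope])
    moreover have "w x * (y - x) \<le> integral {x..R} h - integral {y..R} h"
      "integral {x..R} h - integral {y..R} h \<le> w y * (y - x)"
      using integral_mono_on_bounds[OF mono, of x y] xy a b by (simp_all add: wh)
    ultimately show "\<bar>D y - D x\<bar> \<le> (w y - w x) * (y - x)"
      unfolding D_def left_diff_distrib by linarith
  qed (use b in simp)
  have "continuous_on {0..R} (\<lambda>r. integral {r..R} h)"
    by (intro indefinite_integral_continuous_1' integrable_on_mono_on mono)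
  then have "((\<lambda>r. integral {r..R} h) \<longlongrightarrow> integral {R..R} h) (at R within {0..R})"
    using a unfolding continuous_on_def by (elim bspec) simp
  then have "((\<lambda>r. integral {r..R} h) \<longlongrightarrow> 0) (at_left R)"
    using a by (simp add: at_within_Icc_at_left)
  with lim have "(D \<longlongrightarrow> 0 + 0) (at_left R)"
    unfolding D_def by (rule tendsto_add)
  moreover have "eventually (\<lambda>b. D b = D a) (at_left R)"
    using const a by (intro eventually_at_leftI[of a]) auto
  ultimately have "((\<lambda>_. D a) \<longlongrightarrow> 0) (at_left R)"
    by (simp add: tendsto_cong)
  then have "D a = 0"
    by (simp add: tendsto_const_iff)
  then show ?thesis by (simp add: D_def)
qed

text \<open>Continuity from below along increasing open balls. The case \<open>r = R\<close> is
  included for the closed endpoint of the monotonicity condition.\<close>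

lemma measure_ball_left_cont:
  fixes \<mu> :: "'a::euclidean_space measure"
  assumes fin: "finite_measure \<mu>" and s: "sets \<mu> = sets (restrict_space borel (ball 0 R))"
    and r: "0 < r" "r \<le> R"
  shows "((\<lambda>r. measure \<mu> (ball 0 r)) \<longlongrightarrow> measure \<mu> (ball 0 r)) (at_left r)"
proof (rule tendsto_at_left_sequentially[OF r(1)])
  interpret finite_measure \<mu> by fact
  fix S :: "nat \<Rightarrow> real"
  assume S: "\<And>n. S n < r" "incseq S" "S \<longlonglongrightarrow> r"
  have "(\<lambda>n. measure \<mu> (ball 0 (S n))) \<longlonglongrightarrow> measure \<mu> (\<Union>n. ball 0 (S n))"
  proof (rule finite_Lim_measure_incseq)
    have "ball (0::'a) (S n) \<subseteq> ball 0 R" for n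
      using less_le_trans[OF S(1) r(2), of n] by auto
    then show "range (\<lambda>n. ball 0 (S n)) \<subseteq> sets \<mu>"
      by (simp add: image_subset_iff sets_restrict_ball(1)[OF s])
    show "incseq (\<lambda>n. ball (0::'a) (S n))"
      unfolding incseq_def using incseqD[OF S(2)] subset_ball by blast
  qed
  moreover have "(\<Union>n. ball 0 (S n)) = ball (0::'a) r"
  proof (intro equalityI subsetI)
    fix x :: 'a assume "x \<in> ball 0 r"
    then have "eventually (\<lambda>n. norm x < S n) sequentially"
      using order_tendstoD(1)[OF S(3)] by simp
    then obtain n where "norm x < S n" by (metis eventually_happens sequentially_bot)
    then show "x \<in> (\<Union>n. ball 0 (S n))" by auto
  next
    fix x :: 'a assume "x \<in> (\<Union>n. ball 0 (S n))"
    then show "x \<in> ball 0 r" using S(1) by (auto intro: less_trans)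
  qed
  ultimately show "(\<lambda>n. measure \<mu> (ball 0 (S n))) \<longlonglongrightarrow> measure \<mu> (ball 0 r)" by simp
qed

lemma powr_inverse_power:
  fixes x :: real
  assumes "0 \<le> x" "k \<ge> 1"
  shows "(x ^ k) powr (1 / real k) = x" "(x powr (1 / real k)) ^ k = x"
  using assms by (cases "x = 0"; simp add: powr_realpow[symmetric] powr_powr)+

section \<open>The slope prescribed by the measure\<close>

lemma hessian_slope:
  fixes \<mu> :: "'a::euclidean_space measure"
  assumes R: "R > 0" and s: "sets \<mu> = sets (restrict_space borel (ball 0 R))"
    and fin: "finite_measure \<mu>" and k: "k \<ge> 1" and c: "c > 0"
    and ratio: "mono_on {0<..R} (\<lambda>r. measure \<mu> (ball 0 r) / r ^ m)"
  defines "h \<equiv> \<lambda>r. (measure \<mu> (ball 0 r) / (c * r ^ m)) powr (1 / real k)"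
  shows "mono_on {0..R} h" and "slope_function R (\<lambda>r. - integral {r..R} h) h"
proof -
  \<comment> \<open>\<open>ball 0 0\<close> is empty, so the numerator vanishes; this also covers
    \<open>m = 0\<close>, where the denominator is \<open>c\<close>.\<close>
  have h0: "h 0 = 0" by (simp add: h_def)
  show mono: "mono_on {0..R} h"
  proof (rule mono_onI)
    fix x y assume xy: "x \<in> {0..R}" "y \<in> {0..R}" "x \<le> y"
    show "h x \<le> h y"
    proof (cases "x = 0")
      case True
      then show ?thesis by (simp add: h0) (simp add: h_def)
    next
      case False
      then have "measure \<mu> (ball 0 x) / x ^ m \<le> measure \<mu> (ball 0 y) / y ^ m"
        using xy by (intro mono_onD[OF ratio]) auto
      then have "measure \<mu> (ball 0 x) / x ^ m / c \<le> measure \<mu> (ball 0 y) / y ^ m / c"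
        using c by (intro divide_right_mono) auto
      then have "measure \<mu> (ball 0 x) / (c * x ^ m) \<le> measure \<mu> (ball 0 y) / (c * y ^ m)"
        by (simp only: divide_divide_eq_left mult.commute)
      then show ?thesis
        unfolding h_def using xy c by (intro powr_mono2) auto
    qed
  qed
  show "slope_function R (\<lambda>r. - integral {r..R} h) h"
  proof (rule slope_function_integral[OF mono h0])
    fix r assume r: "0 < r" "r < R"
    have "((\<lambda>r. measure \<mu> (ball 0 r) / (c * r ^ m)) \<longlongrightarrow> measure \<mu> (ball 0 r) / (c * r ^ m)) (at_left r)"
      using r c by (intro tendsto_intros measure_ball_left_cont[OF fin s]) auto
    then show "(h \<longlongrightarrow> h r) (at_left r)"
      unfolding h_def
    proof (rule tendsto_powr2)
      show "eventually (\<lambda>r. 0 \<le> measure \<mu> (ball 0 r) / (c * r ^ m)) (at_left r)"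
        using r c by (intro eventually_at_leftI[of 0]) auto
    qed (use k in auto)
  qed
qed

lemma zero_boundary_values_profile:
  fixes u :: "'a::euclidean_space \<Rightarrow> real"
  assumes R: "R > 0" and z: "zero_boundary_values (ball 0 R) u"
    and u: "\<And>x. norm x < R \<Longrightarrow> u x = \<phi> (norm x)"
  shows "(\<phi> \<longlongrightarrow> 0) (at_left R)"
proof -
  obtain v where v: "continuous_on (cball 0 R) v" "\<And>x. norm x < R \<Longrightarrow> v x = u x"
    "\<And>x. norm x = R \<Longrightarrow> v x = 0"
    using z R by (auto simp: zero_boundary_values_def)
  obtain e :: 'a where e: "norm e = 1" by (rule vector_choose_size[of 1]) simp_all
  have "continuous_on {0..R} (\<lambda>r. v (r *\<^sub>R e))"
    by (rule continuous_on_compose2[OF v(1)]) (auto intro!: continuous_intros simp: e)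
  then have "((\<lambda>r. v (r *\<^sub>R e)) \<longlongrightarrow> v (R *\<^sub>R e)) (at R within {0..R})"
    using R by (auto simp: continuous_on_def)
  then have "((\<lambda>r. v (r *\<^sub>R e)) \<longlongrightarrow> 0) (at_left R)"
    using R e by (simp add: at_within_Icc_at_left v(3))
  moreover have "eventually (\<lambda>r. v (r *\<^sub>R e) = \<phi> r) (at_left R)"
    using R e by (intro eventually_at_leftI[of 0]) (auto simp: v(2) u)
  ultimately show ?thesis by (simp add: tendsto_cong)
qed

text \<open>The slope of a solution is determined by \<open>\<mu>\<close> on balls: evaluating the Hessian measure of a
  radial function on \<open>ball 0 r\<close> gives a multiple of \<open>r ^ (n - k) * w r ^ k\<close>.\<close>

lemma radial_hessian_solution_imp:
  fixes \<mu> :: "(real^'n) measure"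
  assumes card: "CARD('n) \<ge> 2" and R: "R > 0"
    and s: "sets \<mu> = sets (restrict_space borel (ball 0 R))" and fin: "finite_measure \<mu>"
    and k: "k \<in> {1..CARD('n)}" and sol: "radial_hessian_solution R k \<mu> u"
  defines "c \<equiv> real (CARD('n) choose k) * measure lborel (ball (0::real^'n) 1)"
  shows "mono_on {0<..R} (\<lambda>r. measure \<mu> (ball 0 r) / r ^ (CARD('n) - k))"
    and "norm x < R \<Longrightarrow> u x = - integral {norm x..R}
      (\<lambda>r. (measure \<mu> (ball 0 r) / (c * r ^ (CARD('n) - k))) powr (1 / real k))"
proof -
  let ?m = "CARD('n) - k"
  have c: "c > 0" using k by (simp add: c_def)
  have sol': "radially_symmetric_on (ball 0 R) u" "convex_on (ball 0 R) u"
    "hessian_measure (ball 0 R) k u = \<mu>" "zero_boundary_values (ball 0 R) u"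
    using sol by (simp_all add: radial_hessian_solution_def)
  obtain \<phi> w where slope: "slope_function R \<phi> w" and u: "\<And>x. norm x < R \<Longrightarrow> u x = \<phi> (norm x)"
    using radial_convex_profile[OF R sol'(2,1)] by blast
  have \<mu>: "\<mu> = radial_measure R (hessian_radius CARD('n) w k)"
    using hessian_measure_radial[OF card R slope u, of k] k sol'(3) by simp
  have w: "0 \<le> w r" if "0 < r" "r < R" for r using slope_nonneg[OF slope] that by simp
  have meas: "measure \<mu> (ball 0 r) = c * r ^ ?m * w r ^ k" if r: "0 < r" "r < R" for r
  proof -
    have "emeasure \<mu> (ball 0 r) = ennreal (c * r ^ ?m * w r ^ k)"
      using emeasure_hessian_radius_ball[OF slope r, of k, where 'a="real^'n"]
      unfolding \<mu> c_def by (simp add: content_ball mult_ac)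
    then show ?thesis using c r w[OF r] by (simp add: measure_def)
  qed
  \<comment> \<open>For radii below \<open>R\<close> the ratio equals \<open>c * w r ^ k\<close>, so
    it inherits monotonicity from the slope.\<close>
  have ratio_lt: "measure \<mu> (ball 0 r) / r ^ ?m \<le> measure \<mu> (ball 0 r') / r' ^ ?m"
    if r: "0 < r" "r \<le> r'" "r' < R" for r r'
  proof -
    have "c * w r ^ k \<le> c * w r' ^ k"
      using c r w[of r] slope_mono[OF slope, of r r'] by (intro mult_left_mono power_mono) auto
    then show ?thesis using r by (simp add: meas)
  qed
  \<comment> \<open>The slope gives no information at \<open>R\<close> itself; the endpoint is
    reached by left continuity of the ball masses.\<close>
  have ratio_R: "measure \<mu> (ball 0 r) / r ^ ?m \<le> measure \<mu> (ball 0 R) / R ^ ?m"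
    if r: "0 < r" "r < R" for r
  proof (rule tendsto_lowerbound)
    show "((\<lambda>r. measure \<mu> (ball 0 r) / r ^ ?m) \<longlongrightarrow> measure \<mu> (ball 0 R) / R ^ ?m) (at_left R)"
      using R by (intro tendsto_intros measure_ball_left_cont[OF fin s]) auto
    show "eventually (\<lambda>r'. measure \<mu> (ball 0 r) / r ^ ?m \<le> measure \<mu> (ball 0 r') / r' ^ ?m) (at_left R)"
      using ratio_lt r by (intro eventually_at_leftI[of r]) auto
  qed simp
  show ratio: "mono_on {0<..R} (\<lambda>r. measure \<mu> (ball 0 r) / r ^ ?m)"
  proof (rule mono_onI)
    fix x y assume xy: "x \<in> {0<..R}" "y \<in> {0<..R}" "x \<le> y"
    then consider "y < R" | "y = R" "x < R" | "x = y" by fastforce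
    then show "measure \<mu> (ball 0 x) / x ^ ?m \<le> measure \<mu> (ball 0 y) / y ^ ?m"
      using xy ratio_lt[of x y] ratio_R[of x] by cases auto
  qed
  define h where "h r = (measure \<mu> (ball 0 r) / (c * r ^ ?m)) powr (1 / real k)" for r
  have mono: "mono_on {0..R} h"
    using hessian_slope(1)[OF R s fin _ c ratio, of k] k by (simp add: h_def[abs_def])
  have wh: "w r = h r" if "0 \<le> r" "r < R" for r
  proof (cases "r = 0")
    case True
    then show ?thesis by (simp add: h_def slope_zero[OF slope])
  next
    case False
    then have "h r = (w r ^ k) powr (1 / real k)"
      using that c by (simp add: h_def meas)
    then show ?thesis using powr_inverse_power(1)[of "w r" k] w[of r] that False k by simp
  qed
  have lim: "(\<phi> \<longlongrightarrow> 0) (at_left R)"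
    by (rule zero_boundary_values_profile[OF R sol'(4) u])
  show "u x = - integral {norm x..R}
      (\<lambda>r. (measure \<mu> (ball 0 r) / (c * r ^ ?m)) powr (1 / real k))" if "norm x < R"
    using profile_eq_integral[OF slope mono wh lim, of "norm x"] that by (simp add: u h_def[abs_def])
qed

text \<open>The monotone ratio makes \<open>h\<close> non-decreasing, hence the slope of a convex
  profile. Its \<open>k\<close>-th power cancels the root, so the Hessian measure and
  \<open>\<mu>\<close> agree on centred balls and therefore everywhere.\<close>

lemma radial_hessian_solution_exists:
  fixes \<mu> :: "(real^'n) measure"
  assumes card: "CARD('n) \<ge> 2" and R: "R > 0"
    and s: "sets \<mu> = sets (restrict_space borel (ball 0 R))" and fin: "finite_measure \<mu>"
    and rot: "rotation_invariant \<mu>" and k: "k \<in> {1..CARD('n)}"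
    and ratio: "mono_on {0<..R} (\<lambda>r. measure \<mu> (ball 0 r) / r ^ (CARD('n) - k))"
  shows "\<exists>u. radial_hessian_solution R k \<mu> u"
proof -
  interpret finite_measure \<mu> by fact
  let ?m = "CARD('n) - k"
  define c where "c = real (CARD('n) choose k) * measure lborel (ball (0::real^'n) 1)"
  have c: "c > 0" using k by (simp add: c_def)
  define h where "h r = (measure \<mu> (ball 0 r) / (c * r ^ ?m)) powr (1 / real k)" for r
  define \<phi> where "\<phi> r = - integral {r..R} h" for r
  have mono: "mono_on {0..R} h" and slope: "slope_function R \<phi> h"
    using hessian_slope[OF R s fin _ c ratio, of k] k by (simp_all add: h_def[abs_def] \<phi>_def[abs_def])
  define u :: "real^'n \<Rightarrow> real" where "u = restrict (\<lambda>x. \<phi> (norm x)) (ball 0 R)"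
  have u: "u x = \<phi> (norm x)" if "norm x < R" for x using that by (simp add: u_def)
  have "radial_hessian_solution R k \<mu> u"
    unfolding radial_hessian_solution_def
  proof (intro conjI)
    show "u \<in> extensional (ball 0 R)" by (simp add: u_def)
    show "radially_symmetric_on (ball 0 R) u" by (simp add: radially_symmetric_on_def u)
    show "convex_on (ball 0 R) u" by (rule convex_radial[OF slope u])
    have n: "CARD('n) > 0" by simp
    have "radial_measure R (hessian_radius CARD('n) h k) = \<mu>"
    proof (rule rotation_invariant_eqI[OF card R])
      show "rotation_invariant (radial_measure R (hessian_radius CARD('n) h k) :: (real^'n) measure)"
        by (rule rotation_invariant_radial_measure[OF left_cont_mono_hessian_radius[OF slope n]])
    next
      fix r assume r: "0 < r" "r < R"
      have "emeasure (radial_measure R (hessian_radius CARD('n) h k)) (ball (0::real^'n) r) =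
          ennreal (c * r ^ ?m * h r ^ k)"
        using emeasure_hessian_radius_ball[OF slope r, of k, where 'a="real^'n"]
        unfolding c_def by (simp add: content_ball mult_ac)
      also have "h r ^ k = measure \<mu> (ball 0 r) / (c * r ^ ?m)"
        unfolding h_def using c r k by (intro powr_inverse_power(2)) auto
      also have "c * r ^ ?m * (measure \<mu> (ball 0 r) / (c * r ^ ?m)) = measure \<mu> (ball 0 r)"
        using c r by simp
      finally show "emeasure (radial_measure R (hessian_radius CARD('n) h k)) (ball (0::real^'n) r) =
          emeasure \<mu> (ball 0 r)" and "emeasure (radial_measure R (hessian_radius CARD('n) h k)) (ball (0::real^'n) r) < \<infinity>"
        by (simp_all add: emeasure_eq_measure)
    qed (simp_all add: s rot)
    then show "hessian_measure (ball 0 R) k u = \<mu>"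
      using hessian_measure_radial[OF card R slope u, of k] k by simp
    show "zero_boundary_values (ball 0 R) u"
      unfolding zero_boundary_values_def
    proof (intro exI[of _ "\<lambda>x. \<phi> (norm x)"] conjI ballI)
      have "continuous_on {0..R} \<phi>"
        unfolding \<phi>_def by (intro continuous_on_minus indefinite_integral_continuous_1' integrable_on_mono_on mono)
      then have "continuous_on (cball 0 R) (\<lambda>x::real^'n. \<phi> (norm x))"
        by (rule continuous_on_compose2) (auto intro!: continuous_intros)
      then show "continuous_on (closure (ball 0 R)) (\<lambda>x::real^'n. \<phi> (norm x))" using R by simp
      fix x :: "real^'n"
      show "\<phi> (norm x) = u x" if "x \<in> ball 0 R" using that by (simp add: u)
      show "\<phi> (norm x) = 0" if "x \<in> frontier (ball 0 R)"
        using that R by (simp add: \<phi>_def)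
    qed
  qed
  then show ?thesis by blast
qed

theorem theorem1p2:
  fixes \<mu> :: "(real^'n) measure" and R :: real and k :: nat
  assumes "CARD('n) \<ge> 2"
    and "R > 0"
    and "sets \<mu> = sets (restrict_space borel (ball 0 R))"
    and "finite_measure \<mu>"
    and "rotation_invariant \<mu>"
    and "k \<in> {1..CARD('n)}"
  shows "((\<exists>!u. radial_hessian_solution R k \<mu> u) \<longleftrightarrow>
        mono_on {0<..R} (\<lambda>r. measure \<mu> (ball 0 r) / r ^ (CARD('n) - k)))
    \<and> (mono_on {0<..R} (\<lambda>r. measure \<mu> (ball 0 r) / r ^ (CARD('n) - k)) \<longrightarrow>
        (\<forall>u. radial_hessian_solution R k \<mu> u \<longrightarrow>
          (\<forall>x\<in>ball 0 R. u x =
            - integral {norm x..R} (\<lambda>r.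
                (measure \<mu> (ball 0 r) /
                  (real (CARD('n) choose k) * measure lborel (ball (0::real^'n) 1) * r ^ (CARD('n) - k)))
                powr (1 / real k)))))"
proof -
  note solution = radial_hessian_solution_imp[OF assms(1-4,6)]
  \<comment> \<open>The integral formula fixes both functions on the ball and extensionality fixes
    them outside, so unique existence reduces to existence.\<close>
  have unique: "u = v" if "radial_hessian_solution R k \<mu> u" "radial_hessian_solution R k \<mu> v" for u v
  proof (rule extensionalityI[of _ "ball 0 R"])
    show "u \<in> extensional (ball 0 R)" "v \<in> extensional (ball 0 R)"
      using that by (simp_all add: radial_hessian_solution_def)
    show "u x = v x" if "x \<in> ball 0 R" for x
      using solution(2)[OF \<open>radial_hessian_solution R k \<mu> u\<close>, of x]
        solution(2)[OF \<open>radial_hessian_solution R k \<mu> v\<close>, of x] that by simp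
  qed
  have "(\<exists>!u. radial_hessian_solution R k \<mu> u) \<longleftrightarrow>
      mono_on {0<..R} (\<lambda>r. measure \<mu> (ball 0 r) / r ^ (CARD('n) - k))"
    using solution(1) unique radial_hessian_solution_exists[OF assms] by blast
  then show ?thesis using solution(2) by simp
qed

end
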